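(* Let $\Omega\subset\mathbb{R}^N$ be a uniformly convex domain, let $f\in C(\Omega)\cap L^\infty(\Omega)$, and let $u$ satisfy $$\begin{cases}\mathcal{I}_1^+u(x)=f(x)&\text{in }\Omega\\ u=0&\text{in }\mathbb{R}^N\setminus\Omega.\end{cases}$$ If $s>\frac12$, then $u$ is H\"older continuous of order $2s-1$ in $\mathbb{R}^N$.
   Context: Here $s\in(0,1)$ is the fixed fractional order. A uniformly convex domain is a bounded domain $\Omega\subset\mathbb{R}^N$ of the form $\Omega=\bigcap_{y\in Y}B_R(y)$ for some $R>0$ and some set $Y\subset\mathbb{R}^N$, where $B_R(y)$ is the ball of center $y$ and radius $R$. Set $\delta(u,x,y)=u(x+y)+u(x-y)-2u(x)$ and let $C_s=C_{1,s}>0$ be the normalizing constant of the one-dimensional fractional Laplacian. The operator is $\mathcal{I}_1^+u(x)=\sup_{|\xi|=1}\mathcal{I}_\xi u(x)$, where $\mathcal{I}_\xi u(x)=C_s\int_0^{+\infty}\delta(u,x,\tau\xi)\tau^{-1-2s}\,d\tau$. Viscosity solutions: $u\in L^\infty(\mathbb{R}^N)\cap LSC(\Omega)$ (resp. $USC(\Omega)$) is a supersolution (resp. subsolution) of $\mathcal{I}_1^+u=f$ in $\Omega$ if for every $x_0\in\Omega$, $\rho>0$ and $\varphi\in C^2(B_\rho(x_0))$ such that $x_0$ is a minimum (resp. maximum) point of $u-\varphi$ in $B_\rho(x_0)$, $$C_s\sup_{|\xi|=1}\left(\int_0^\rho\frac{\delta(\varphi,x_0,\tau\xi)}{\tau^{1+2s}}\,d\tau+\int_\rho^{+\infty}\frac{\delta(u,x_0,\tau\xi)}{\tau^{1+2s}}\,d\tau\right)\le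 f(x_0)\quad(\text{resp. }\ge f(x_0)).$$ A solution is a continuous function that is both a subsolution and a supersolution. *)

theory Defs
  imports "HOL-Analysis.Analysis"
begin

(* Open balls: Omega is itself required to be open. *)
definition uniformly_convex_domain :: "(real ^ 'n) set \<Rightarrow> bool" where
  "uniformly_convex_domain \<Omega> \<longleftrightarrow>
     open \<Omega> \<and> connected \<Omega> \<and> \<Omega> \<noteq> {} \<and> bounded \<Omega> \<and>
     (\<exists>R>0. \<exists>Y. \<Omega> = (\<Inter>y\<in>Y. ball y R))"

(* Bounded Borel functions, not classes modulo null sets: viscosity solutions are evaluated
   pointwise and integrated along lines, which are null sets for N > 1.  A function that is
   continuous on an open set and vanishes outside it belongs to this set as soon as it is
   essentially bounded. *)
definition L_infinity :: "(real ^ 'n) set \<Rightarrow> (real ^ 'n \<Rightarrow> real) set" where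
  "L_infinity S = {g. g \<in> borel_measurable (restrict_space borel S) \<and> bounded (g ` S)}"

definition lsc_on :: "(real ^ 'n) set \<Rightarrow> (real ^ 'n \<Rightarrow> real) \<Rightarrow> bool" where
  "lsc_on S g \<longleftrightarrow> (\<forall>x\<in>S. \<forall>a<g x. \<forall>\<^sub>F y in at x within S. a < g y)"

definition usc_on :: "(real ^ 'n) set \<Rightarrow> (real ^ 'n \<Rightarrow> real) \<Rightarrow> bool" where
  "usc_on S g \<longleftrightarrow> (\<forall>x\<in>S. \<forall>a>g x. \<forall>\<^sub>F y in at x within S. g y < a)"

(* Meant for open S: D and H are the first and second Frechet derivatives of g. *)
definition C2_on :: "(real ^ 'n) set \<Rightarrow> (real ^ 'n \<Rightarrow> real) \<Rightarrow> bool" where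
  "C2_on S g \<longleftrightarrow>
     (\<exists>(D :: real ^ 'n \<Rightarrow> (real ^ 'n) \<Rightarrow>\<^sub>L real)
       (H :: real ^ 'n \<Rightarrow> (real ^ 'n) \<Rightarrow>\<^sub>L ((real ^ 'n) \<Rightarrow>\<^sub>L real)).
        (\<forall>x\<in>S. (g has_derivative blinfun_apply (D x)) (at x) \<and>
               (D has_derivative blinfun_apply (H x)) (at x)) \<and>
        continuous_on S H)"

definition second_diff :: "(real ^ 'n \<Rightarrow> real) \<Rightarrow> real ^ 'n \<Rightarrow> real ^ 'n \<Rightarrow> real" where
  "second_diff u x y = u (x + y) + u (x - y) - 2 * u x"

(* The constant C_{1,s} for which C_{1,s} * (integral over tau > 0 of
   (u(x+tau) + u(x-tau) - 2 u(x)) / tau^(1+2s)) is the operator on the real line with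
   Fourier symbol -|k|^(2s), i.e. minus the fractional Laplacian of order s. *)
definition frac_const :: "real \<Rightarrow> real" where
  "frac_const s = 4 powr s * s * Gamma (1/2 + s) / (sqrt pi * Gamma (1 - s))"

(* Lebesgue integral with values in the extended reals.  Below at most one of the two parts is
   infinite, so the difference is never of the form infinity - infinity. *)
definition ext_integral :: "real set \<Rightarrow> (real \<Rightarrow> real) \<Rightarrow> ereal" where
  "ext_integral A g =
     enn2ereal (\<integral>\<^sup>+ \<tau>\<in>A. ennreal (g \<tau>) \<partial>lborel) - enn2ereal (\<integral>\<^sup>+ \<tau>\<in>A. ennreal (- g \<tau>) \<partial>lborel)"

(* A test function phi is C^2 only on the open ball, and it is bounded there only from above
   (when it touches u from below) or only from below (when it touches u from above).  The first
   integral may therefore be -infinity, respectively +infinity, which is why the value is an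
   extended real. *)
definition visc_I1_plus ::
    "real \<Rightarrow> real \<Rightarrow> (real ^ 'n \<Rightarrow> real) \<Rightarrow> (real ^ 'n \<Rightarrow> real) \<Rightarrow> real ^ 'n \<Rightarrow> ereal" where
  "visc_I1_plus s \<rho> \<phi> u x =
     ereal (frac_const s) *
       (SUP \<xi>\<in>sphere 0 1.
          ext_integral {0<..<\<rho>} (\<lambda>\<tau>. second_diff \<phi> x (\<tau> *\<^sub>R \<xi>) / \<tau> powr (1 + 2 * s)) +
          ext_integral {\<rho><..} (\<lambda>\<tau>. second_diff u x (\<tau> *\<^sub>R \<xi>) / \<tau> powr (1 + 2 * s)))"

definition viscosity_supersolution ::
    "real \<Rightarrow> (real ^ 'n) set \<Rightarrow> (real ^ 'n \<Rightarrow> real) \<Rightarrow> (real ^ 'n \<Rightarrow> real) \<Rightarrow> bool" where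
  "viscosity_supersolution s \<Omega> f u \<longleftrightarrow>
     u \<in> L_infinity UNIV \<and> lsc_on \<Omega> u \<and>
     (\<forall>x0\<in>\<Omega>. \<forall>\<rho>>0. \<forall>\<phi>.
        C2_on (ball x0 \<rho>) \<phi> \<and> (\<forall>x\<in>ball x0 \<rho>. u x0 - \<phi> x0 \<le> u x - \<phi> x) \<longrightarrow>
        visc_I1_plus s \<rho> \<phi> u x0 \<le> ereal (f x0))"

definition viscosity_subsolution ::
    "real \<Rightarrow> (real ^ 'n) set \<Rightarrow> (real ^ 'n \<Rightarrow> real) \<Rightarrow> (real ^ 'n \<Rightarrow> real) \<Rightarrow> bool" where
  "viscosity_subsolution s \<Omega> f u \<longleftrightarrow>
     u \<in> L_infinity UNIV \<and> usc_on \<Omega> u \<and>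
     (\<forall>x0\<in>\<Omega>. \<forall>\<rho>>0. \<forall>\<phi>.
        C2_on (ball x0 \<rho>) \<phi> \<and> (\<forall>x\<in>ball x0 \<rho>. u x - \<phi> x \<le> u x0 - \<phi> x0) \<longrightarrow>
        visc_I1_plus s \<rho> \<phi> u x0 \<ge> ereal (f x0))"

(* Continuity is required in Omega only; none is assumed across the boundary of Omega. *)
definition viscosity_solution ::
    "real \<Rightarrow> (real ^ 'n) set \<Rightarrow> (real ^ 'n \<Rightarrow> real) \<Rightarrow> (real ^ 'n \<Rightarrow> real) \<Rightarrow> bool" where
  "viscosity_solution s \<Omega> f u \<longleftrightarrow>
     continuous_on \<Omega> u \<and> viscosity_subsolution s \<Omega> f u \<and> viscosity_supersolution s \<Omega> f u"

definition holder_continuous_on :: "real \<Rightarrow> (real ^ 'n) set \<Rightarrow> (real ^ 'n \<Rightarrow> real) \<Rightarrow> bool" where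
  "holder_continuous_on \<alpha> S g \<longleftrightarrow>
     (\<exists>L. \<forall>x\<in>S. \<forall>y\<in>S. \<bar>g x - g y\<bar> \<le> L * dist x y powr \<alpha>)"

end

theory Submission
  imports Defs "HOL-Real_Asymp.Real_Asymp"
begin

text \<open>
  Put \<open>\<alpha> = 2 * s - 1\<close>.  Among powers, \<open>\<bar>t\<bar> powr \<alpha>\<close> is the fundamental solution on the line: its
  operator vanishes away from \<open>0\<close>, and every integral that occurs has an explicit primitive.

  As all directional operators are bounded above on \<open>u\<close>, the cone
  \<open>u y - L * (min (dist x y) 1) powr \<alpha>\<close>, whose truncation makes the operator in the radial direction
  at least a positive multiple of \<open>L\<close>, stays below \<open>u\<close> as soon as it does so outside \<open>\<Omega>\<close>.
  There \<open>u = 0\<close>, so what is needed is \<open>u y \<le> K * dist y z powr \<alpha>\<close> for \<open>z \<notin> \<Omega>\<close>.  This follows by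
  comparing \<open>u\<close> with a multiple of the power \<open>\<alpha>\<close> of the height above the tangent hyperplane of a
  ball \<open>ball y R \<supseteq> \<Omega>\<close>, cut off outside that ball: the curvature of the ball makes all
  directional operators at most a negative constant.

  Since \<open>u\<close> may a priori jump at the boundary, the extremum in the comparison argument need not be
  attained; a quadratic bump adapted to the shape of \<open>\<Omega>\<close> makes it so.
\<close>

subsection \<open>Integrals against the fractional kernel\<close>

text \<open>Integrability and value form one relation, so that linearity carries both along. Here
  \<open>h t\<close> stands for a second difference at distance \<open>t\<close> along a line; the
  factor \<open>frac_const s\<close> is left out.\<close>

definition has_frac_integral :: "real \<Rightarrow> (real \<Rightarrow> real) \<Rightarrow> real \<Rightarrow> bool" where
  "has_frac_integral s h I \<longleftrightarrow>
     has_bochner_integral lborel (\<lambda>t. indicator {0<..} t *\<^sub>R (h t / t powr (1 + 2 * s))) I"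

lemma has_frac_integral_add:
  "has_frac_integral s g I \<Longrightarrow> has_frac_integral s h J \<Longrightarrow>
   has_frac_integral s (\<lambda>t. g t + h t) (I + J)"
  unfolding has_frac_integral_def
  by (drule (1) has_bochner_integral_add) (simp add: algebra_simps add_divide_distrib)

lemma has_frac_integral_cmult:
  "has_frac_integral s g I \<Longrightarrow> has_frac_integral s (\<lambda>t. c * g t) (c * I)"
  unfolding has_frac_integral_def
  using has_bochner_integral_mult_right[of c lborel "\<lambda>t. indicator {0<..} t *\<^sub>R (g t / t powr (1 + 2 * s))" I]
  by (simp add: algebra_simps)

lemma has_frac_integral_diff:
  "has_frac_integral s g I \<Longrightarrow> has_frac_integral s h J \<Longrightarrow>
   has_frac_integral s (\<lambda>t. g t - h t) (I - J)"
  using has_frac_integral_add[OF _ has_frac_integral_cmult[of s h J "-1"], of g I] by simp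

text \<open>Substitution of \<open>c * t\<close> for \<open>t\<close>: the homogeneity of the weight
  t^(-1-2s) dt is the order 2s of the operator.\<close>

lemma has_frac_integral_scale:
  assumes h: "has_frac_integral s h I" and "0 < c"
  shows "has_frac_integral s (\<lambda>t. h (c * t)) (c powr (2 * s) * I)"
proof -
  let ?f = "\<lambda>t. indicator {0<..} t *\<^sub>R (h t / t powr (1 + 2 * s))"
  have "has_bochner_integral lborel (\<lambda>t. ?f (0 + c * t)) (I /\<^sub>R \<bar>c\<bar>)"
    using h assms(2) unfolding has_frac_integral_def
    by (subst (asm) lborel_has_bochner_integral_real_affine_iff[where c = c and t = 0]) auto
  then have "has_bochner_integral lborel (\<lambda>t. c powr (1 + 2 * s) * ?f (c * t))
               (c powr (1 + 2 * s) * (I /\<^sub>R \<bar>c\<bar>))"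
    by (intro has_bochner_integral_mult_right) simp
  moreover have "(\<lambda>t. c powr (1 + 2 * s) * ?f (c * t)) =
      (\<lambda>t. indicator {0<..} t *\<^sub>R (h (c * t) / t powr (1 + 2 * s)))"
    using assms(2) by (auto simp: fun_eq_iff indicator_def zero_less_mult_iff powr_mult)
  moreover have "c powr (1 + 2 * s) * (I /\<^sub>R \<bar>c\<bar>) = c powr (2 * s) * I"
    using assms(2) by (simp add: powr_add field_simps)
  ultimately show ?thesis
    unfolding has_frac_integral_def by (simp only: add_0)
qed

text \<open>For a nonnegative integrand the limits of a primitive at both ends give integrability as
  well as the value. The right end is an extended real, which covers bounded and unbounded intervals
  at once.\<close>

lemma has_frac_integral_FTC:
  fixes F h :: "real \<Rightarrow> real" and b :: ereal
  assumes "0 \<le> a" "ereal a < b"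
    and F: "\<And>t. a < t \<Longrightarrow> ereal t < b \<Longrightarrow> (F has_real_derivative h t / t powr (1 + 2 * s)) (at t)"
    and h: "\<And>t. a < t \<Longrightarrow> ereal t < b \<Longrightarrow> isCont h t"
    and nonneg: "\<And>t. a < t \<Longrightarrow> ereal t < b \<Longrightarrow> 0 \<le> h t"
    and lim: "(F \<longlongrightarrow> A) (at_right a)"
             "((F \<circ> real_of_ereal) \<longlongrightarrow> B) (at_left b)"
  shows "has_frac_integral s (\<lambda>t. if a < t \<and> ereal t < b then h t else 0) (B - A)"
proof -
  let ?f = "\<lambda>t. h t / t powr (1 + 2 * s)"
  have lA: "((F \<circ> real_of_ereal) \<longlongrightarrow> A) (at_right (ereal a))"
    using lim(1) by (simp add: ereal_tendsto_simps)
  note FTC = interval_integral_FTC_nonneg[of a b F ?f, OF assms(2) _ _ _ lA lim(2)]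
  have c: "isCont ?f t" if "a < t" "ereal t < b" for t
    using that assms(1) h[of t] by (auto intro!: continuous_intros)
  have n: "AE x in lborel. ereal a < ereal x \<longrightarrow> ereal x < b \<longrightarrow> 0 \<le> ?f x"
    using nonneg by auto
  have 1: "set_integrable lborel (einterval a b) ?f"
    by (rule FTC(1)) (use F c n in auto)
  have 2: "(LBINT x=a..b. ?f x) = B - A"
    by (rule FTC(2)) (use F c n in auto)
  have "(\<lambda>t. indicator (einterval a b) t *\<^sub>R ?f t) =
        (\<lambda>t. indicator {0<..} t *\<^sub>R ((if a < t \<and> ereal t < b then h t else 0) / t powr (1 + 2 * s)))"
    using assms(1) by (auto simp: fun_eq_iff indicator_def einterval_def)
  moreover have "has_bochner_integral lborel (\<lambda>t. indicator (einterval a b) t *\<^sub>R ?f t) (B - A)"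
    using 1 2 less_imp_le[OF assms(2)]
    by (simp add: has_bochner_integral_iff set_integrable_def interval_lebesgue_integral_def
        set_lebesgue_integral_def mult.assoc)
  ultimately show ?thesis
    unfolding has_frac_integral_def by simp
qed

lemma tendsto_compose_real_of_ereal_PInf:
  "(F \<longlongrightarrow> B) at_top \<Longrightarrow> ((F \<circ> real_of_ereal) \<longlongrightarrow> B) (at_left \<infinity>)"
  by (simp add: ereal_tendsto_simps)

lemma tendsto_compose_real_of_ereal:
  "(F \<longlongrightarrow> B) (at_left b) \<Longrightarrow> ((F \<circ> real_of_ereal) \<longlongrightarrow> B) (at_left (ereal b))"
  by (simp add: ereal_tendsto_simps)

lemma powr_minus_eq_divide:
  assumes "0 < (t::real)"
  shows "t powr (- 2 * s) = t / t powr (1 + 2 * s)"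
    and "t powr (- 2 * s - 1) = 1 / t powr (1 + 2 * s)"
proof -
  have "t powr (- 2 * s) * t powr (1 + 2 * s) = t" "t powr (- 2 * s - 1) * t powr (1 + 2 * s) = 1"
    using assms by (simp_all only: powr_add[symmetric]) simp_all
  then show "t powr (- 2 * s) = t / t powr (1 + 2 * s)"
      "t powr (- 2 * s - 1) = 1 / t powr (1 + 2 * s)"
    using assms by (simp_all add: field_simps)
qed

lemma powr_eq_mult_powr: "0 < (x::real) \<Longrightarrow> x powr (2 * s) = x * x powr (2 * s - 1)"
  by (simp add: powr_diff)

text \<open>The common shape of the primitives of shifted powers; \<open>G'\<close> is the
  derivative of \<open>G\<close> divided by 2s. For \<open>G t = (1 + t) powr (2 * s)\<close> the
  expression \<open>t * G' - G t\<close> collapses to \<open>- ((1 + t) powr (2 * s - 1))\<close>,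
  which is why the exponent 2s - 1 fits this kernel.\<close>

lemma has_real_derivative_times_powr_minus:
  assumes t: "0 < (t::real)" "0 < s" and G: "(G has_real_derivative 2 * s * G') (at t)"
    and eq: "t * G' - G t = h"
  shows "((\<lambda>t. G t * t powr (- 2 * s) / (2 * s)) has_real_derivative h / t powr (1 + 2 * s)) (at t)"
proof (rule DERIV_cong)
  have "((\<lambda>t. t powr (- 2 * s)) has_real_derivative - 2 * s * t powr (- 2 * s - 1)) (at t)"
    using t by (auto intro!: derivative_eq_intros)
  from DERIV_cdivide[OF DERIV_mult[OF G this], of "2 * s"]
  show "((\<lambda>t. G t * t powr (- 2 * s) / (2 * s)) has_real_derivative
      (2 * s * G' * t powr (- 2 * s) + - 2 * s * t powr (- 2 * s - 1) * G t) / (2 * s)) (at t)" .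
  have "2 * s * G' * (t / D) + - 2 * s * (1 / D) * G t = (2 * s) * ((t * G' - G t) / D)" for D
    by (simp add: diff_divide_distrib algebra_simps)
  then show "(2 * s * G' * t powr (- 2 * s) + - 2 * s * t powr (- 2 * s - 1) * G t) / (2 * s) =
      h / t powr (1 + 2 * s)"
    using t eq by (simp only: powr_minus_eq_divide) simp
qed

section \<open>Explicit integrals of shifted powers\<close>

context
  fixes s :: real
  assumes s: "1/2 < s" "s < 1"
begin

lemma has_frac_integral_tail:
  assumes "0 < a"
  shows "has_frac_integral s (\<lambda>t. if a < t then 1 else 0) (a powr (- 2 * s) / (2 * s))"
proof -
  have "has_frac_integral s (\<lambda>t. if a < t \<and> ereal t < \<infinity> then 1 else 0)
          (0 - (- (a powr (- 2 * s) / (2 * s))))"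
  proof (rule has_frac_integral_FTC[where F = "\<lambda>t. - (t powr (- 2 * s) / (2 * s))"])
    show "((\<lambda>t. - (t powr (- 2 * s) / (2 * s))) has_real_derivative 1 / t powr (1 + 2 * s)) (at t)"
      if "a < t" for t
      using has_real_derivative_times_powr_minus[of t s "\<lambda>_. - 1" 0 1] that assms s by simp
    show "((\<lambda>t. - (t powr (- 2 * s) / (2 * s))) \<longlongrightarrow> - (a powr (- 2 * s) / (2 * s))) (at_right a)"
      using assms s by (auto intro!: tendsto_intros)
    have "((\<lambda>t. - (t powr (- 2 * s) / (2 * s))) \<longlongrightarrow> 0) at_top"
      using s by real_asymp (simp add: field_simps)?
    then show "(((\<lambda>t. - (t powr (- 2 * s) / (2 * s))) \<circ> real_of_ereal) \<longlongrightarrow> 0) (at_left \<infinity>)"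
      by (rule tendsto_compose_real_of_ereal_PInf)
  qed (use assms in auto)
  then show ?thesis by simp
qed

lemma has_frac_integral_square:
  "has_frac_integral s (\<lambda>t. if 0 < t \<and> t < 1 then t\<^sup>2 else 0) (1 / (2 - 2 * s))"
proof -
  have "has_frac_integral s (\<lambda>t. if 0 < t \<and> ereal t < ereal 1 then t\<^sup>2 else 0) (1 / (2 - 2 * s) - 0)"
  proof (rule has_frac_integral_FTC[where F = "\<lambda>t. t powr (2 - 2 * s) / (2 - 2 * s)"])
    show "((\<lambda>t. t powr (2 - 2 * s) / (2 - 2 * s)) has_real_derivative t\<^sup>2 / t powr (1 + 2 * s)) (at t)"
      if "0 < t" for t
    proof (rule DERIV_cong)
      show "((\<lambda>t. t powr (2 - 2 * s) / (2 - 2 * s)) has_real_derivative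
          (2 - 2 * s) * t powr (2 - 2 * s - 1) / (2 - 2 * s)) (at t)"
        using that by (intro DERIV_cdivide has_real_derivative_powr)
      have "t powr (1 - 2 * s) * t powr (1 + 2 * s) = t\<^sup>2"
        using that by (simp only: powr_add[symmetric]) simp
      then have "t powr (1 - 2 * s) = t\<^sup>2 / t powr (1 + 2 * s)"
        using that by (simp add: field_simps)
      then show "(2 - 2 * s) * t powr (2 - 2 * s - 1) / (2 - 2 * s) = t\<^sup>2 / t powr (1 + 2 * s)"
        using s by simp
    qed
    show "((\<lambda>t. t powr (2 - 2 * s) / (2 - 2 * s)) \<longlongrightarrow> 0) (at_right 0)"
      using s by real_asymp
    have "((\<lambda>t. t powr (2 - 2 * s) / (2 - 2 * s)) \<longlongrightarrow> 1 powr (2 - 2 * s) / (2 - 2 * s)) (at_left 1)"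
      using s by (intro tendsto_intros) auto
    then show "(((\<lambda>t. t powr (2 - 2 * s) / (2 - 2 * s)) \<circ> real_of_ereal) \<longlongrightarrow> 1 / (2 - 2 * s))
        (at_left (ereal 1))"
      using tendsto_compose_real_of_ereal by force
  qed (auto intro!: continuous_intros)
  then show ?thesis by simp
qed

text \<open>Concavity of the power, from Young's inequality with second factor 1. It decides the
  sign of second differences at 1.\<close>

lemma powr_le_tangent:
  assumes "0 \<le> (x::real)"
  shows "x powr (2 * s - 1) \<le> 1 + (2 * s - 1) * (x - 1)"
proof (cases "x = 0")
  case False
  then show ?thesis
    using Youngs_inequality_0[of "2 * s - 1" "2 - 2 * s" x 1] s assms by (simp add: algebra_simps)
qed (use s in simp)

lemma has_frac_integral_inner:
  "has_frac_integral s
     (\<lambda>t. if 0 < t \<and> t < 1 then (1 + t) powr (2 * s - 1) + (1 - t) powr (2 * s - 1) - 2 else 0)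
     ((2 - 2 powr (2 * s)) / (2 * s))"
proof -
  \<comment> \<open>By concavity the second difference is nonpositive, so its negative is
    integrated. The \<open>- 2\<close> in \<open>?F\<close> produces the constant 2 in
    \<open>?h\<close> and makes the bracket O(t^2) at 0, whence \<open>?F\<close> tends to 0 there
    because s < 1.\<close>
  let ?h = "\<lambda>t::real. 2 - (1 + t) powr (2 * s - 1) - (1 - t) powr (2 * s - 1)"
  let ?F = "\<lambda>t::real. ((1 + t) powr (2 * s) + (1 - t) powr (2 * s) - 2) * t powr (- 2 * s) / (2 * s)"
  have "has_frac_integral s (\<lambda>t. if 0 < t \<and> ereal t < ereal 1 then ?h t else 0)
     ((2 powr (2 * s) - 2) / (2 * s) - 0)"
  proof (rule has_frac_integral_FTC[where F = ?F])
    show "(?F has_real_derivative ?h t / t powr (1 + 2 * s)) (at t)"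
      if "0 < t" "ereal t < ereal 1" for t
    proof (rule has_real_derivative_times_powr_minus)
      show "((\<lambda>t. (1 + t) powr (2 * s) + (1 - t) powr (2 * s) - 2) has_real_derivative
          2 * s * ((1 + t) powr (2 * s - 1) - (1 - t) powr (2 * s - 1))) (at t)"
        using that by (auto intro!: derivative_eq_intros simp: right_diff_distrib)
    qed (use that s powr_eq_mult_powr[of "1 + t" s] powr_eq_mult_powr[of "1 - t" s] in \<open>simp_all add: algebra_simps\<close>)
    show "(?F \<longlongrightarrow> 0) (at_right 0)"
      using s by real_asymp
    have "(?F \<longlongrightarrow> (2 powr (2 * s) - 2) / (2 * s)) (at_left 1)"
      using s by real_asymp (simp add: field_simps)?
    then show "((?F \<circ> real_of_ereal) \<longlongrightarrow> (2 powr (2 * s) - 2) / (2 * s)) (at_left (ereal 1))"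
      by (rule tendsto_compose_real_of_ereal)
    show "0 \<le> ?h t" if "0 < t" "ereal t < ereal 1" for t
      using powr_le_tangent[of "1 + t"] powr_le_tangent[of "1 - t"] that by (simp add: algebra_simps)
  qed (auto intro!: continuous_intros)
  note * = has_frac_integral_cmult[OF this, of "-1"]
  have "(\<lambda>t. - 1 * (if 0 < t \<and> ereal t < ereal 1 then ?h t else 0)) =
      (\<lambda>t. if 0 < t \<and> t < 1 then (1 + t) powr (2 * s - 1) + (1 - t) powr (2 * s - 1) - 2 else 0)"
    by (auto simp: fun_eq_iff)
  moreover have "- 1 * ((2 powr (2 * s) - 2) / (2 * s) - 0) = (2 - 2 powr (2 * s)) / (2 * s)"
    by (simp add: diff_divide_distrib)
  ultimately show ?thesis
    using * by (simp only:)
qed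

lemma has_frac_integral_outer_plus:
  "has_frac_integral s (\<lambda>t. if 1 < t then (1 + t) powr (2 * s - 1) else 0)
     ((2 powr (2 * s) - 1) / (2 * s))"
proof -
  let ?F = "\<lambda>t::real. - ((1 + t) powr (2 * s)) * t powr (- 2 * s) / (2 * s)"
  have "has_frac_integral s (\<lambda>t. if 1 < t \<and> ereal t < \<infinity> then (1 + t) powr (2 * s - 1) else 0)
     (- (1 / (2 * s)) - (- (2 powr (2 * s) / (2 * s))))"
  proof (rule has_frac_integral_FTC[where F = ?F])
    show "(?F has_real_derivative (1 + t) powr (2 * s - 1) / t powr (1 + 2 * s)) (at t)"
      if "1 < t" for t
    proof (rule has_real_derivative_times_powr_minus)
      show "((\<lambda>t. - ((1 + t) powr (2 * s))) has_real_derivative 2 * s * - ((1 + t) powr (2 * s - 1)))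
          (at t)"
        using that by (auto intro!: derivative_eq_intros)
    qed (use that s powr_eq_mult_powr[of "1 + t" s] powr_eq_mult_powr[of "1 - t" s] in \<open>simp_all add: algebra_simps\<close>)
    have "(?F \<longlongrightarrow> - ((1 + 1) powr (2 * s)) * 1 powr (- 2 * s) / (2 * s)) (at_right 1)"
      using s by (intro tendsto_intros) auto
    then show "(?F \<longlongrightarrow> - (2 powr (2 * s) / (2 * s))) (at_right 1)"
      by simp
    have "(?F \<longlongrightarrow> - (1 / (2 * s))) at_top"
      using s by real_asymp (simp add: field_simps)?
    then show "((?F \<circ> real_of_ereal) \<longlongrightarrow> - (1 / (2 * s))) (at_left \<infinity>)"
      by (rule tendsto_compose_real_of_ereal_PInf)
  qed (auto intro!: continuous_intros)
  moreover have "- (1 / (2 * s)) - (- (2 powr (2 * s) / (2 * s))) = (2 powr (2 * s) - 1) / (2 * s)"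
    by (simp add: diff_divide_distrib)
  ultimately show ?thesis by simp
qed

lemma has_frac_integral_outer_minus:
  "has_frac_integral s (\<lambda>t. if 1 < t then (t - 1) powr (2 * s - 1) else 0) (1 / (2 * s))"
proof -
  let ?F = "\<lambda>t::real. (t - 1) powr (2 * s) * t powr (- 2 * s) / (2 * s)"
  have "has_frac_integral s (\<lambda>t. if 1 < t \<and> ereal t < \<infinity> then (t - 1) powr (2 * s - 1) else 0)
     (1 / (2 * s) - 0)"
  proof (rule has_frac_integral_FTC[where F = ?F])
    show "(?F has_real_derivative (t - 1) powr (2 * s - 1) / t powr (1 + 2 * s)) (at t)"
      if "1 < t" for t
    proof (rule has_real_derivative_times_powr_minus)
      show "((\<lambda>t. (t - 1) powr (2 * s)) has_real_derivative 2 * s * (t - 1) powr (2 * s - 1)) (at t)"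
        using that by (auto intro!: derivative_eq_intros)
    qed (use that s powr_eq_mult_powr[of "t - 1" s] in \<open>simp_all add: algebra_simps\<close>)
    show "(?F \<longlongrightarrow> 0) (at_right 1)"
      using s by real_asymp
    have "(?F \<longlongrightarrow> 1 / (2 * s)) at_top"
      using s by real_asymp (simp add: field_simps)?
    then show "((?F \<circ> real_of_ereal) \<longlongrightarrow> 1 / (2 * s)) (at_left \<infinity>)"
      by (rule tendsto_compose_real_of_ereal_PInf)
  qed (auto intro!: continuous_intros)
  then show ?thesis by simp
qed

end

subsection \<open>One-dimensional kernels\<close>

lemma powr_diff_frac:
  "0 \<le> \<kappa> \<Longrightarrow> 0 < p \<Longrightarrow>
    p powr (2 * s - 1) * (\<kappa> / p) powr (2 * s) = \<kappa> powr (2 * s) / (p::real)"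
  by (simp add: powr_divide powr_diff)

context
  fixes s :: real
  assumes s: "1/2 < s" "s < 1"
begin

text \<open>The profile max(0, x)^(2s-1), seen from x = 1, has a strictly negative operator, since
  (2 - 2^(2s)) + (2^(2s) - 1) - 2 = -1. As in the related lemmas, an integrable majorant of the
  second difference is produced, because the comparison arguments use one-sided bounds.\<close>

lemma one_sided_kernel:
  obtains k where "has_frac_integral s k (- 1 / (2 * s))"
    and "\<And>t. 0 < t \<Longrightarrow> (1 + t) powr (2 * s - 1) + (max 0 (1 - t)) powr (2 * s - 1) - 2 \<le> k t"
proof
  let ?k = "\<lambda>t. (if 0 < t \<and> t < 1 then (1 + t) powr (2 * s - 1) + (1 - t) powr (2 * s - 1) - 2 else 0)
    + (if 1 < t then (1 + t) powr (2 * s - 1) else 0) - 2 * (if 1 < t then 1 else 0 :: real)"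
  have "has_frac_integral s ?k
      ((2 - 2 powr (2 * s)) / (2 * s) + (2 powr (2 * s) - 1) / (2 * s) - 2 * (1 powr (- 2 * s) / (2 * s)))"
    by (intro has_frac_integral_diff has_frac_integral_add has_frac_integral_cmult
        has_frac_integral_inner[OF s] has_frac_integral_outer_plus[OF s] has_frac_integral_tail[OF s]) simp
  moreover have "(2 - 2 powr (2 * s)) / (2 * s) + (2 powr (2 * s) - 1) / (2 * s)
      - 2 * (1 powr (- 2 * s) / (2 * s)) = - 1 / (2 * s)"
    by (simp add: diff_divide_distrib)
  ultimately show "has_frac_integral s ?k (- 1 / (2 * s))"
    by (simp only:)
  show "(1 + t) powr (2 * s - 1) + (max 0 (1 - t)) powr (2 * s - 1) - 2 \<le> ?k t" if "0 < t" for t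
    \<comment> \<open>Equality holds except at \<open>t = 1\<close>, where all pieces of
      \<open>?k\<close> are 0 and 2^(2s-1) \<le> 2 is what remains.\<close>
    using that powr_le_tangent[OF s, of 2] s by (cases t "1::real" rule: linorder_cases) auto
qed

text \<open>Passing to the even profile |x|^(2s-1) adds (t - 1)^(2s-1) beyond t = 1, whose integral
  1/(2s) cancels the value of the one-sided profile exactly.\<close>

lemma cone_kernel:
  obtains k where "has_frac_integral s k 0"
    and "\<And>t. 0 < t \<Longrightarrow> (1 + t) powr (2 * s - 1) + \<bar>1 - t\<bar> powr (2 * s - 1) - 2 \<le> k t"
proof -
  obtain k where k: "has_frac_integral s k (- 1 / (2 * s))"
    "\<And>t. 0 < t \<Longrightarrow> (1 + t) powr (2 * s - 1) + (max 0 (1 - t)) powr (2 * s - 1) - 2 \<le> k t"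
    using one_sided_kernel by blast
  show thesis
  proof (rule that)
    let ?k = "\<lambda>t. k t + (if 1 < t then (t - 1) powr (2 * s - 1) else 0)"
    show "has_frac_integral s ?k 0"
      using has_frac_integral_add[OF k(1) has_frac_integral_outer_minus[OF s]] by simp
    show "(1 + t) powr (2 * s - 1) + \<bar>1 - t\<bar> powr (2 * s - 1) - 2 \<le> ?k t" if "0 < t" for t
      using k(2)[OF that] by (cases "t \<le> 1") (auto simp: max_def)
  qed
qed

text \<open>Rescaling of \<open>one_sided_kernel\<close>: the factor p^(2s-1) from the height and
  (\<kappa>/p)^(2s) from the speed combine to \<kappa>^(2s)/p. For \<open>\<kappa> = 0\<close> the
  scaling factor degenerates, but the second difference vanishes.\<close>

lemma one_sided_kernel_affine:
  assumes "0 < p" "0 \<le> \<kappa>"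
  obtains k where "has_frac_integral s k (- (\<kappa> powr (2 * s) / p / (2 * s)))"
    and "\<And>\<tau>. 0 < \<tau> \<Longrightarrow> (p + \<kappa> * \<tau>) powr (2 * s - 1) + (max 0 (p - \<kappa> * \<tau>)) powr (2 * s - 1)
           - 2 * p powr (2 * s - 1) \<le> k \<tau>"
proof (cases "\<kappa> = 0")
  case True
  show thesis
  proof (rule that)
    show "has_frac_integral s (\<lambda>_. 0) (- (\<kappa> powr (2 * s) / p / (2 * s)))"
      using True s by (simp add: has_frac_integral_def has_bochner_integral_zero)
  qed (use True assms in simp)
next
  case False
  obtain k where k: "has_frac_integral s k (- 1 / (2 * s))"
    "\<And>t. 0 < t \<Longrightarrow> (1 + t) powr (2 * s - 1) + (max 0 (1 - t)) powr (2 * s - 1) - 2 \<le> k t"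
    using one_sided_kernel by blast
  show thesis
  proof (rule that)
    have "has_frac_integral s (\<lambda>t. p powr (2 * s - 1) * k (\<kappa> / p * t))
            (p powr (2 * s - 1) * ((\<kappa> / p) powr (2 * s) * (- 1 / (2 * s))))"
      using assms False by (intro has_frac_integral_cmult has_frac_integral_scale k) simp
    moreover have "p powr (2 * s - 1) * ((\<kappa> / p) powr (2 * s) * (- 1 / (2 * s))) =
        - (\<kappa> powr (2 * s) / p / (2 * s))"
      using powr_diff_frac[OF assms(2,1), of s] by (simp add: field_simps)
    ultimately show "has_frac_integral s (\<lambda>t. p powr (2 * s - 1) * k (\<kappa> / p * t))
        (- (\<kappa> powr (2 * s) / p / (2 * s)))"
      by (simp only:)
    show "(p + \<kappa> * \<tau>) powr (2 * s - 1) + (max 0 (p - \<kappa> * \<tau>)) powr (2 * s - 1)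
           - 2 * p powr (2 * s - 1) \<le> p powr (2 * s - 1) * k (\<kappa> / p * \<tau>)" if "0 < \<tau>" for \<tau>
    proof -
      have 1: "p + \<kappa> * \<tau> = p * (1 + \<kappa> / p * \<tau>)" and 2: "max 0 (p - \<kappa> * \<tau>) = p * max 0 (1 - \<kappa> / p * \<tau>)"
        using assms by (auto simp: algebra_simps max_def)
      have 3: "(p * (1 + \<kappa> / p * \<tau>)) powr (2 * s - 1) =
          p powr (2 * s - 1) * (1 + \<kappa> / p * \<tau>) powr (2 * s - 1)"
        and 4: "(p * max 0 (1 - \<kappa> / p * \<tau>)) powr (2 * s - 1) = p powr (2 * s - 1) * max 0 (1 - \<kappa> / p * \<tau>) powr (2 * s - 1)"
        using assms that by (simp_all add: powr_mult)
      have "p powr (2 * s - 1) * ((1 + \<kappa> / p * \<tau>) powr (2 * s - 1) +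
          (max 0 (1 - \<kappa> / p * \<tau>)) powr (2 * s - 1) - 2) \<le> p powr (2 * s - 1) * k (\<kappa> / p * \<tau>)"
        using that assms False by (intro mult_left_mono k) auto
      then show ?thesis
        unfolding 1 2 3 4 by (simp only: right_diff_distrib distrib_left mult.commute[of _ 2])
    qed
  qed
qed

lemma cone_kernel_scaled:
  assumes "0 < r"
  obtains k where "has_frac_integral s k 0"
    and "\<And>\<tau>. 0 < \<tau> \<Longrightarrow> (r + \<tau>) powr (2 * s - 1) + \<bar>r - \<tau>\<bar> powr (2 * s - 1)
           - 2 * r powr (2 * s - 1) \<le> k \<tau>"
proof -
  obtain k where k: "has_frac_integral s k 0"
    "\<And>t. 0 < t \<Longrightarrow> (1 + t) powr (2 * s - 1) + \<bar>1 - t\<bar> powr (2 * s - 1) - 2 \<le> k t"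
    using cone_kernel by blast
  show thesis
  proof (rule that)
    have "has_frac_integral s (\<lambda>t. r powr (2 * s - 1) * k (1 / r * t))
            (r powr (2 * s - 1) * ((1 / r) powr (2 * s) * 0))"
      using assms by (intro has_frac_integral_cmult has_frac_integral_scale k) simp
    then show "has_frac_integral s (\<lambda>t. r powr (2 * s - 1) * k (1 / r * t)) 0"
      by simp
    show "(r + \<tau>) powr (2 * s - 1) + \<bar>r - \<tau>\<bar> powr (2 * s - 1)
           - 2 * r powr (2 * s - 1) \<le> r powr (2 * s - 1) * k (1 / r * \<tau>)" if "0 < \<tau>" for \<tau>
    proof -
      have 1: "r + \<tau> = r * (1 + 1 / r * \<tau>)" and 2: "\<bar>r - \<tau>\<bar> = r * \<bar>1 - 1 / r * \<tau>\<bar>"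
        using assms by (auto simp: algebra_simps abs_if)
      have 3: "(r * (1 + 1 / r * \<tau>)) powr (2 * s - 1) =
          r powr (2 * s - 1) * (1 + 1 / r * \<tau>) powr (2 * s - 1)"
        and 4: "(r * \<bar>1 - 1 / r * \<tau>\<bar>) powr (2 * s - 1) = r powr (2 * s - 1) * \<bar>1 - 1 / r * \<tau>\<bar> powr (2 * s - 1)"
        using assms that by (simp_all add: powr_mult)
      have "r powr (2 * s - 1) * ((1 + 1 / r * \<tau>) powr (2 * s - 1) +
          \<bar>1 - 1 / r * \<tau>\<bar> powr (2 * s - 1) - 2) \<le> r powr (2 * s - 1) * k (1 / r * \<tau>)"
        using that assms by (intro mult_left_mono k) auto
      then show ?thesis
        unfolding 1 2 3 4 by (simp only: right_diff_distrib distrib_left mult.commute[of _ 2])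
    qed
  qed
qed

text \<open>For \<tau> > 2 the truncated profile equals 1 at distance r + \<tau>, while the full one
  is at least 2^(2s-1). So truncation lowers the value 0 of the full cone by an amount independent
  of \<open>r\<close>.\<close>

lemma truncated_cone_kernel:
  obtains c where "0 < c"
    and "\<And>r. 0 < r \<Longrightarrow> r < 1 \<Longrightarrow> \<exists>k. has_frac_integral s k (- c) \<and>
      (\<forall>\<tau>>0. (min (r + \<tau>) 1) powr (2 * s - 1) + (min \<bar>r - \<tau>\<bar> 1) powr (2 * s - 1)
           - 2 * r powr (2 * s - 1) \<le> k \<tau>)"
proof (rule that)
  let ?d = "2 powr (2 * s - 1) - 1 :: real"
  \<comment> \<open>The loss \<open>?d\<close> times the mass of the kernel beyond 2.\<close>
  let ?c = "?d * (2 powr (- 2 * s) / (2 * s))"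
  have d: "0 < ?d" using s by simp
  then show "0 < ?c" using s by simp
  fix r :: real assume r: "0 < r" "r < 1"
  obtain k where k: "has_frac_integral s k 0"
    "\<And>\<tau>. 0 < \<tau> \<Longrightarrow> (r + \<tau>) powr (2 * s - 1) + \<bar>r - \<tau>\<bar> powr (2 * s - 1)
           - 2 * r powr (2 * s - 1) \<le> k \<tau>"
    using cone_kernel_scaled[OF r(1)] by blast
  let ?k = "\<lambda>t. k t - ?d * (if 2 < t then 1 else 0)"
  have "has_frac_integral s ?k (0 - ?c)"
    by (intro has_frac_integral_diff has_frac_integral_cmult k has_frac_integral_tail[OF s]) simp
  moreover have "(min (r + \<tau>) 1) powr (2 * s - 1) + (min \<bar>r - \<tau>\<bar> 1) powr (2 * s - 1)
           - 2 * r powr (2 * s - 1) \<le> ?k \<tau>" if "0 < \<tau>" for \<tau>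
  proof -
    have "(min \<bar>r - \<tau>\<bar> 1) powr (2 * s - 1) \<le> \<bar>r - \<tau>\<bar> powr (2 * s - 1)"
      using s by (intro powr_mono2) auto
    moreover have "(min (r + \<tau>) 1) powr (2 * s - 1) \<le> (r + \<tau>) powr (2 * s - 1) - ?d * (if 2 < \<tau> then 1 else 0)"
    proof (cases "2 < \<tau>")
      case True
      then have "min (r + \<tau>) 1 = 1" and "2 powr (2 * s - 1) \<le> (r + \<tau>) powr (2 * s - 1)"
        using r s by (auto intro!: powr_mono2)
      then show ?thesis using True by simp
    next
      case False
      then show ?thesis using r that s by (auto intro!: powr_mono2)
    qed
    ultimately show ?thesis
      using k(2)[OF that] by simp
  qed
  ultimately show "\<exists>k. has_frac_integral s k (- ?c) \<and>
      (\<forall>\<tau>>0. (min (r + \<tau>) 1) powr (2 * s - 1) + (min \<bar>r - \<tau>\<bar> 1) powr (2 * s - 1)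
           - 2 * r powr (2 * s - 1) \<le> k \<tau>)"
    by (intro exI[of _ ?k]) simp
qed

text \<open>Here \<open>p\<close> is the height of a point of a ball of radius \<open>R\<close> above a tangent hyperplane, \<open>\<kappa>\<close> is the
  slope of a line through it, and \<open>3 * sqrt (2 * R * p) + 2 * \<kappa> * R\<close> bounds the time at which the
  line leaves the ball.  Steep lines (\<open>\<kappa>\<^sup>2 \<ge> p\<close>) gain from crossing the hyperplane, flat ones from
  leaving the ball.\<close>

lemma cap_kernel:
  assumes R: "0 < R"
  obtains c where "0 < c"
    and "\<And>p \<kappa>. 0 < p \<Longrightarrow> p \<le> 2 * R \<Longrightarrow> 0 \<le> \<kappa> \<Longrightarrow> \<exists>k I. has_frac_integral s k I \<and> I \<le> - c \<and>
      (\<forall>\<tau>>0. (if \<tau> \<le> 3 * sqrt (2 * R * p) + 2 * \<kappa> * R then (p + \<kappa> * \<tau>) powr (2 * s - 1) else 0)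
         + (max 0 (p - \<kappa> * \<tau>)) powr (2 * s - 1) - 2 * p powr (2 * s - 1) \<le> k \<tau>)"
proof (rule that)
  \<comment> \<open>If \<open>\<kappa> < sqrt p\<close>, the exit time is at most
    \<open>?B * sqrt p\<close>. In both cases the gain is then at least a multiple of p^(s-1), which
    is at least (2R)^(s-1) as s < 1; \<open>?c\<close> takes the smaller multiple.\<close>
  let ?B = "3 * sqrt (2 * R) + 2 * R"
  let ?c = "min 1 (?B powr (- 2 * s)) * (2 * R) powr (s - 1) / (2 * s)"
  have B: "0 < ?B" using R by (simp add: add_pos_pos)
  then show "0 < ?c" using R s by simp
  fix p \<kappa> :: real assume p: "0 < p" "p \<le> 2 * R" and \<kappa>: "0 \<le> \<kappa>"
  let ?b = "3 * sqrt (2 * R * p) + 2 * \<kappa> * R"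
  have b: "0 < ?b" using R p \<kappa> by (simp add: add_pos_nonneg)
  obtain k where k: "has_frac_integral s k (- (\<kappa> powr (2 * s) / p / (2 * s)))"
    "\<And>\<tau>. 0 < \<tau> \<Longrightarrow> (p + \<kappa> * \<tau>) powr (2 * s - 1) + (max 0 (p - \<kappa> * \<tau>)) powr (2 * s - 1)
           - 2 * p powr (2 * s - 1) \<le> k \<tau>"
    using one_sided_kernel_affine[OF p(1) \<kappa>] by blast
  let ?k = "\<lambda>t. k t - p powr (2 * s - 1) * (if ?b < t then 1 else 0)"
  \<comment> \<open>The first term is the gain from crossing the hyperplane, the second the gain
    from leaving the ball by time \<open>?b\<close>.\<close>
  let ?I = "- (\<kappa> powr (2 * s) / p / (2 * s)) - p powr (2 * s - 1) * (?b powr (- 2 * s) / (2 * s))"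
  have "has_frac_integral s ?k ?I"
    by (intro has_frac_integral_diff has_frac_integral_cmult k has_frac_integral_tail[OF s] b)
  moreover have "?I \<le> - ?c"
  proof -
    have mono: "(2 * R) powr (s - 1) \<le> p powr (s - 1)"
      using p s R by (intro powr_mono2') auto
    have "min 1 (?B powr (- 2 * s)) * (2 * R) powr (s - 1) \<le>
        \<kappa> powr (2 * s) / p + p powr (2 * s - 1) * ?b powr (- 2 * s)"
    proof (cases "sqrt p \<le> \<kappa>")
      case True
      have "min 1 (?B powr (- 2 * s)) * (2 * R) powr (s - 1) \<le> 1 * (2 * R) powr (s - 1)"
        by (intro mult_right_mono) auto
      also have "\<dots> \<le> p powr (s - 1)" using mono by simp
      also have "\<dots> = sqrt p powr (2 * s) / p"
        using p by (simp add: powr_diff powr_half_sqrt[symmetric] powr_powr)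
      also have "\<dots> \<le> \<kappa> powr (2 * s) / p"
        using True p s by (intro divide_right_mono powr_mono2) auto
      also have "\<dots> \<le> \<kappa> powr (2 * s) / p + p powr (2 * s - 1) * ?b powr (- 2 * s)"
        by simp
      finally show ?thesis .
    next
      case False
      have "min 1 (?B powr (- 2 * s)) * (2 * R) powr (s - 1) \<le> ?B powr (- 2 * s) * p powr (s - 1)"
        using mono by (intro mult_mono) auto
      also have "\<dots> = p powr (2 * s - 1) * (?B * sqrt p) powr (- 2 * s)"
      proof -
        have "p powr (s - 1) = p powr (2 * s - 1) * sqrt p powr (- 2 * s)"
          using p by (simp add: powr_half_sqrt[symmetric] powr_powr powr_add[symmetric])
        then show ?thesis using B p by (simp add: powr_mult)
      qed
      also have "\<dots> \<le> p powr (2 * s - 1) * ?b powr (- 2 * s)"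
      proof (intro mult_left_mono powr_mono2')
        have "\<kappa> * R \<le> sqrt p * R" using False R by (intro mult_right_mono) auto
        then show "?b \<le> ?B * sqrt p"
          by (simp add: real_sqrt_mult algebra_simps)
      qed (use b s in auto)
      also have "\<dots> \<le> \<kappa> powr (2 * s) / p + p powr (2 * s - 1) * ?b powr (- 2 * s)"
        using p by simp
      finally show ?thesis .
    qed
    then have "min 1 (?B powr (- 2 * s)) * (2 * R) powr (s - 1) / (2 * s) \<le>
        (\<kappa> powr (2 * s) / p + p powr (2 * s - 1) * ?b powr (- 2 * s)) / (2 * s)"
      using s by (intro divide_right_mono) auto
    then show ?thesis by (simp add: add_divide_distrib)
  qed
  moreover have "(if \<tau> \<le> ?b then (p + \<kappa> * \<tau>) powr (2 * s - 1) else 0)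
         + (max 0 (p - \<kappa> * \<tau>)) powr (2 * s - 1) - 2 * p powr (2 * s - 1) \<le> ?k \<tau>" if "0 < \<tau>" for \<tau>
  proof -
    \<comment> \<open>After time \<open>?b\<close> a term of at least
      \<open>p powr (2 * s - 1)\<close> is replaced by 0, which pays for the tail subtracted in
      \<open>?k\<close>.\<close>
    have "p powr (2 * s - 1) \<le> (p + \<kappa> * \<tau>) powr (2 * s - 1)"
      using p \<kappa> that s by (intro powr_mono2) auto
    then show ?thesis using k(2)[OF that] by auto
  qed
  ultimately show "\<exists>k I. has_frac_integral s k I \<and> I \<le> - ?c \<and>
      (\<forall>\<tau>>0. (if \<tau> \<le> ?b then (p + \<kappa> * \<tau>) powr (2 * s - 1) else 0)
         + (max 0 (p - \<kappa> * \<tau>)) powr (2 * s - 1) - 2 * p powr (2 * s - 1) \<le> k \<tau>)"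
    by blast
qed

text \<open>The terms with \<eta> are the cost of a quadratic bump and of an approximate maximum;
  \<open>S\<close> is the gain beyond time \<Lambda>. The gain has a fixed positive weight, so a
  small \<eta> makes the total nonpositive.\<close>

lemma bump_kernel:
  assumes S: "0 < S" and \<Lambda>: "1 \<le> \<Lambda>"
  obtains \<eta> \<mu> I where "0 < \<eta>" "2 * \<eta> < S" "has_frac_integral s \<mu> I" "I \<le> 0"
    and "\<And>t. 0 < t \<Longrightarrow> t < 1 \<Longrightarrow> 4 * \<eta> * t\<^sup>2 \<le> \<mu> t"
    and "\<And>t. 1 \<le> t \<Longrightarrow> 2 * \<eta> \<le> \<mu> t + (if \<Lambda> < t then S else 0)"
proof -
  \<comment> \<open>\<open>A\<close> is the cost per unit of \<eta> and \<open>T\<close> the gain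
    per unit of \<open>S\<close>; the bound S/3 on \<eta> gives 2\<eta> < S.\<close>
  define A where "A = 4 * (1 / (2 - 2 * s)) + 2 * ((1/2) powr (- 2 * s) / (2 * s))"
  define T where "T = \<Lambda> powr (- 2 * s) / (2 * s)"
  define \<eta> where "\<eta> = min (S / 3) (S * T / A)"
  have A: "0 < A" unfolding A_def using s by (intro add_pos_pos) auto
  have T: "0 < T" unfolding T_def using s \<Lambda> by simp
  have \<eta>: "0 < \<eta>" "2 * \<eta> < S" "\<eta> * A \<le> S * T"
    unfolding \<eta>_def using S A T by (auto simp: field_simps min_def)
  \<comment> \<open>The middle tail starts at 1/2 so that it covers the point \<open>t = 1\<close>,
    where the square is already cut off.\<close>
  let ?\<mu> = "\<lambda>t. 4 * \<eta> * (if 0 < t \<and> t < 1 then t\<^sup>2 else 0) + 2 * \<eta> * (if 1 / 2 < t then 1 else 0)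
     - S * (if \<Lambda> < t then 1 else 0)"
  let ?I = "4 * \<eta> * (1 / (2 - 2 * s)) + 2 * \<eta> * ((1/2) powr (- 2 * s) / (2 * s)) - S * (\<Lambda> powr (- 2 * s) / (2 * s))"
  show thesis
  proof (rule that[of \<eta> ?\<mu> ?I])
    show "has_frac_integral s ?\<mu> ?I"
      using \<Lambda> by (intro has_frac_integral_diff has_frac_integral_add has_frac_integral_cmult
        has_frac_integral_square[OF s] has_frac_integral_tail[OF s]) auto
    have "?I = \<eta> * A - S * T" unfolding A_def T_def by (simp add: algebra_simps)
    then show "?I \<le> 0" using \<eta> by simp
  qed (use \<eta> \<Lambda> in auto)
qed

end

subsection \<open>The extended integral\<close>

text \<open>\<open>nn_integral\<close> is monotone for arbitrary functions, so integrands are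
  compared pointwise without measurability or finiteness, in particular for test functions that are
  unbounded near the edge of their ball.\<close>

lemma ext_integral_mono:
  assumes "\<And>t. t \<in> A \<Longrightarrow> g t \<le> h t"
  shows "ext_integral A g \<le> ext_integral A h"
proof -
  have "(\<integral>\<^sup>+t\<in>A. ennreal (g t) \<partial>lborel) \<le> (\<integral>\<^sup>+t\<in>A. ennreal (h t) \<partial>lborel)"
    using assms by (intro nn_integral_mono) (auto simp: indicator_def intro: ennreal_leI)
  moreover have "(\<integral>\<^sup>+t\<in>A. ennreal (- h t) \<partial>lborel) \<le> (\<integral>\<^sup>+t\<in>A. ennreal (- g t) \<partial>lborel)"
    using assms by (intro nn_integral_mono) (auto simp: indicator_def intro: ennreal_leI)
  ultimately show ?thesis
    unfolding ext_integral_def by (intro ereal_minus_mono) (simp_all add: less_eq_ennreal.rep_eq)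
qed

lemma ext_integral_eq:
  assumes "set_integrable lborel A g"
  shows "ext_integral A g = ereal (LINT t:A|lborel. g t)"
proof -
  let ?f = "\<lambda>t. indicator A t *\<^sub>R g t"
  have f: "integrable lborel ?f" using assms by (simp add: set_integrable_def)
  have "(\<integral>\<^sup>+\<tau>\<in>A. ennreal (c * g \<tau>) \<partial>lborel) = (\<integral>\<^sup>+\<tau>. ennreal (c * ?f \<tau>) \<partial>lborel)" for c
    by (intro nn_integral_cong) (simp add: indicator_def)
  from this[of 1] this[of "-1"]
  have eq: "(\<integral>\<^sup>+\<tau>\<in>A. ennreal (g \<tau>) \<partial>lborel) = (\<integral>\<^sup>+\<tau>. ennreal (?f \<tau>) \<partial>lborel)"
    "(\<integral>\<^sup>+\<tau>\<in>A. ennreal (- g \<tau>) \<partial>lborel) = (\<integral>\<^sup>+\<tau>. ennreal (- ?f \<tau>) \<partial>lborel)"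
    by simp_all
  have "(\<integral>\<^sup>+\<tau>. ennreal (?f \<tau>) \<partial>lborel) < \<infinity>" "(\<integral>\<^sup>+\<tau>. ennreal (- ?f \<tau>) \<partial>lborel) < \<infinity>"
    using f by (auto simp: real_integrable_def less_top[symmetric])
  then obtain p n where "(\<integral>\<^sup>+\<tau>. ennreal (?f \<tau>) \<partial>lborel) = ennreal p" "0 \<le> p"
      "(\<integral>\<^sup>+\<tau>. ennreal (- ?f \<tau>) \<partial>lborel) = ennreal n" "0 \<le> n"
    by (auto simp: less_top_ennreal)
  then show ?thesis
    unfolding ext_integral_def eq set_lebesgue_integral_def real_lebesgue_integral_def[OF f]
    by simp
qed

text \<open>With the same integrand in both halves of \<open>visc_I1_plus\<close> they join up, as
  the point \<rho> is a null set.\<close>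

lemma ext_integral_split:
  assumes h: "has_frac_integral s h I" and "0 < \<rho>"
  shows "ext_integral {0<..<\<rho>} (\<lambda>t. h t / t powr (1 + 2 * s)) +
         ext_integral {\<rho><..} (\<lambda>t. h t / t powr (1 + 2 * s)) = ereal I"
proof -
  let ?h = "\<lambda>t. h t / t powr (1 + 2 * s)"
  have int: "set_integrable lborel {0<..} ?h" and I: "(LINT t:{0<..}|lborel. ?h t) = I"
    using h by (simp_all add: has_frac_integral_def has_bochner_integral_iff set_integrable_def
        set_lebesgue_integral_def)
  have a: "set_integrable lborel {0<..<\<rho>} ?h" and b: "set_integrable lborel {\<rho><..} ?h"
    using assms(2) by (auto intro: set_integrable_subset[OF int])
  have "(LINT t:{0<..<\<rho>} \<union> {\<rho><..}|lborel. ?h t) = (LINT t:{0<..}|lborel. ?h t)"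
  proof (rule set_integral_cong_set)
    show "AE t in lborel. (t \<in> {0<..}) = (t \<in> {0<..<\<rho>} \<union> {\<rho><..})"
      using AE_lborel_singleton[of \<rho>] assms(2) by (auto elim!: eventually_mono)
    show "set_borel_measurable lborel {0<..} ?h"
      using int by (simp add: set_integrable_def set_borel_measurable_def)
    show "set_borel_measurable lborel ({0<..<\<rho>} \<union> {\<rho><..}) ?h"
      using set_integrable_Un[OF a b] by (simp add: set_integrable_def set_borel_measurable_def)
  qed
  moreover have "(LINT t:{0<..<\<rho>} \<union> {\<rho><..}|lborel. ?h t) = (LINT t:{0<..<\<rho>}|lborel. ?h t) + (LINT t:{\<rho><..}|lborel. ?h t)"
    using a b by (intro set_integral_Un) auto
  ultimately show ?thesis
    using I by (simp add: ext_integral_eq[OF a] ext_integral_eq[OF b])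
qed

text \<open>One integrable majorant serves both halves: \<open>g1\<close> is meant for the second
  difference of the test function, \<open>g2\<close> for that of the solution.\<close>

lemma ext_integral_split_le:
  assumes h: "has_frac_integral s h I" and "0 < \<rho>"
    and "\<And>t. 0 < t \<Longrightarrow> t < \<rho> \<Longrightarrow> g1 t \<le> h t" "\<And>t. \<rho> < t \<Longrightarrow> g2 t \<le> h t"
  shows "ext_integral {0<..<\<rho>} (\<lambda>t. g1 t / t powr (1 + 2 * s)) +
         ext_integral {\<rho><..} (\<lambda>t. g2 t / t powr (1 + 2 * s)) \<le> ereal I"
  unfolding ext_integral_split[OF assms(1,2), symmetric]
  using assms(2-) by (intro add_mono ext_integral_mono divide_right_mono) auto

lemma ext_integral_split_ge:
  assumes h: "has_frac_integral s h I" and "0 < \<rho>"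
    and "\<And>t. 0 < t \<Longrightarrow> t < \<rho> \<Longrightarrow> h t \<le> g1 t" "\<And>t. \<rho> < t \<Longrightarrow> h t \<le> g2 t"
  shows "ereal I \<le> ext_integral {0<..<\<rho>} (\<lambda>t. g1 t / t powr (1 + 2 * s)) +
         ext_integral {\<rho><..} (\<lambda>t. g2 t / t powr (1 + 2 * s))"
  unfolding ext_integral_split[OF assms(1,2), symmetric]
  using assms(2-) by (intro add_mono ext_integral_mono divide_right_mono) auto

lemma frac_const_pos: "0 < s \<Longrightarrow> s < 1 \<Longrightarrow> 0 < frac_const s"
  unfolding frac_const_def by (intro divide_pos_pos mult_pos_pos Gamma_real_pos) auto

subsection \<open>Twice differentiable test functions and Auerbach bases\<close>

lemma C2_on_subset: "C2_on T g \<Longrightarrow> S \<subseteq> T \<Longrightarrow> C2_on S g"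
  unfolding C2_on_def by (meson continuous_on_subset subsetD)

lemma C2_on_cong:
  assumes "C2_on S g" "open S" and eq: "\<And>x. x \<in> S \<Longrightarrow> g x = h x"
  shows "C2_on S h"
proof -
  obtain D H where "\<And>x. x \<in> S \<Longrightarrow> (g has_derivative blinfun_apply (D x)) (at x)"
    and "\<And>x. x \<in> S \<Longrightarrow> (D has_derivative blinfun_apply (H x)) (at x)" "continuous_on S H"
    using assms(1) unfolding C2_on_def by blast
  then show ?thesis
    unfolding C2_on_def
    by (intro exI[of _ D] exI[of _ H])
       (auto intro: has_derivative_transform_within_open[OF _ assms(2) _ eq])
qed

lemma C2_on_inner: "C2_on S (\<lambda>x. n \<bullet> x + c)"
  unfolding C2_on_def
proof (intro exI conjI ballI)
  show "((\<lambda>x. n \<bullet> x + c) has_derivative blinfun_apply (blinfun_inner_left n)) (at x)" for x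
    by (auto intro!: derivative_eq_intros simp: inner_commute)
  show "((\<lambda>_. blinfun_inner_left n) has_derivative blinfun_apply 0) (at x)" for x
    by (simp add: zero_blinfun.rep_eq)
qed simp

lemma C2_on_add:
  assumes "C2_on S g" "C2_on S h"
  shows "C2_on S (\<lambda>x. g x + h x)"
proof -
  obtain D H D' H' where
    "\<And>x. x \<in> S \<Longrightarrow> (g has_derivative blinfun_apply (D x)) (at x)"
    "\<And>x. x \<in> S \<Longrightarrow> (D has_derivative blinfun_apply (H x)) (at x)" "continuous_on S H"
    "\<And>x. x \<in> S \<Longrightarrow> (h has_derivative blinfun_apply (D' x)) (at x)"
    "\<And>x. x \<in> S \<Longrightarrow> (D' has_derivative blinfun_apply (H' x)) (at x)" "continuous_on S H'"
    using assms unfolding C2_on_def by blast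
  then show ?thesis
    unfolding C2_on_def
    by (intro exI[of _ "\<lambda>x. D x + D' x"] exI[of _ "\<lambda>x. H x + H' x"] conjI ballI continuous_intros)
       (auto intro!: derivative_eq_intros simp: blinfun.add_left)
qed

lemma C2_on_comp:
  assumes "C2_on S g"
    and F: "\<And>x. x \<in> S \<Longrightarrow> (F has_real_derivative F' (g x)) (at (g x))"
           "\<And>x. x \<in> S \<Longrightarrow> (F' has_real_derivative F'' (g x)) (at (g x))"
    and F'': "continuous_on (g ` S) F''"
  shows "C2_on S (\<lambda>x. F (g x))"
proof -
  obtain D H where D: "\<And>x. x \<in> S \<Longrightarrow> (g has_derivative blinfun_apply (D x)) (at x)"
    and H: "\<And>x. x \<in> S \<Longrightarrow> (D has_derivative blinfun_apply (H x)) (at x)"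
    and cH: "continuous_on S H"
    using assms(1) unfolding C2_on_def by blast
  have cg: "continuous_on S g" and cD: "continuous_on S D"
    using D H by (auto intro!: continuous_at_imp_continuous_on has_derivative_continuous)
  have cF': "continuous_on S (\<lambda>x. F' (g x))"
  proof -
    have "continuous_on (g ` S) F'"
      using F(2) by (auto intro!: continuous_at_imp_continuous_on DERIV_isCont)
    from continuous_on_compose[OF cg this] show ?thesis by (simp add: o_def)
  qed
  have cF'': "continuous_on S (\<lambda>x. F'' (g x))"
    using continuous_on_compose[OF cg F''] by (simp add: o_def)
  \<comment> \<open>The second derivative of the composition: F'(g) D^2 g plus the rank one term
    F''(g) Dg \<otimes> Dg, written as a composition of bounded linear maps.\<close>
  let ?H = "\<lambda>x. F' (g x) *\<^sub>R H x + (blinfun_scaleR_left (D x) o\<^sub>L (F'' (g x) *\<^sub>R D x))"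
  have 1: "((\<lambda>x. F (g x)) has_derivative blinfun_apply (F' (g x) *\<^sub>R D x)) (at x)" if "x \<in> S" for x
  proof -
    have "((\<lambda>x. F (g x)) has_derivative (\<lambda>h. D x h * F' (g x))) (at x)"
      using has_derivative_compose[OF D[OF that], of F "\<lambda>h. h * F' (g x)"] F(1)[OF that]
      by (simp add: has_field_derivative_def mult_commute_abs)
    then show ?thesis
      by (rule has_derivative_eq_rhs) (auto simp: blinfun.scaleR_left fun_eq_iff)
  qed
  have 2: "((\<lambda>x. F' (g x) *\<^sub>R D x) has_derivative blinfun_apply (?H x)) (at x)" if "x \<in> S" for x
  proof -
    have "((\<lambda>x. F' (g x)) has_derivative (\<lambda>h. F'' (g x) * D x h)) (at x)"
      using has_derivative_compose[OF D[OF that], of F' "(*) (F'' (g x))"] F(2)[OF that]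
      by (simp add: has_field_derivative_def)
    from has_derivative_scaleR[OF this H[OF that]] show ?thesis
      by (rule has_derivative_eq_rhs) (auto simp: blinfun.bilinear_simps fun_eq_iff)
  qed
  have 3: "continuous_on S ?H"
    by (intro continuous_intros cF' cF'' cH cD
        bounded_bilinear.continuous_on[OF bounded_bilinear_blinfun_compose]
        bounded_linear.continuous_on[OF bounded_linear_blinfun_scaleR_left])
  show ?thesis
    unfolding C2_on_def
    by (intro exI[of _ "\<lambda>x. F' (g x) *\<^sub>R D x"] exI[of _ ?H] conjI ballI 1 2 3)
qed

lemma C2_on_cmult: "C2_on S g \<Longrightarrow> C2_on S (\<lambda>x. c * g x)"
  by (rule C2_on_comp[where F' = "\<lambda>_. c" and F'' = "\<lambda>_. 0"])
     (auto intro!: derivative_eq_intros)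

lemma C2_on_const: "C2_on S (\<lambda>x. c)"
  using C2_on_inner[of S 0 c] by simp

lemma C2_on_diff: "C2_on S g \<Longrightarrow> C2_on S h \<Longrightarrow> C2_on S (\<lambda>x. g x - h x)"
  using C2_on_add[OF _ C2_on_cmult[of S h "-1"]] by simp

lemma C2_on_power2: "C2_on S g \<Longrightarrow> C2_on S (\<lambda>x. (g x)\<^sup>2)"
  by (rule C2_on_comp[where F' = "\<lambda>t. 2 * t" and F'' = "\<lambda>_. 2"])
     (auto intro!: derivative_eq_intros)

lemma C2_on_powr:
  assumes "C2_on S g" "\<And>x. x \<in> S \<Longrightarrow> 0 < g x"
  shows "C2_on S (\<lambda>x. g x powr a)"
proof (rule C2_on_comp[OF assms(1)])
  fix x assume "x \<in> S"
  then have x: "0 < g x" by (rule assms(2))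
  show "((\<lambda>t. t powr a) has_real_derivative a * g x powr (a - 1)) (at (g x))"
    by (rule has_real_derivative_powr[OF x])
  show "((\<lambda>t. a * t powr (a - 1)) has_real_derivative a * ((a - 1) * g x powr (a - 1 - 1))) (at (g x))"
    by (intro DERIV_cmult has_real_derivative_powr[OF x])
qed (use assms(2) in \<open>force intro!: continuous_intros\<close>)

lemma C2_on_sum: "finite I \<Longrightarrow> (\<And>i. i \<in> I \<Longrightarrow> C2_on S (g i)) \<Longrightarrow> C2_on S (\<lambda>x. \<Sum>i\<in>I. g i x)"
  by (induction I rule: finite_induct) (auto intro: C2_on_const C2_on_add)

text \<open>A sum of squares of affine functions; the adjoint turns each coordinate of
  \<open>T (x - a)\<close> into an inner product with \<open>x\<close> plus a constant.\<close>

lemma C2_on_norm_linear: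
  fixes T :: "real ^ 'n \<Rightarrow> real ^ 'n"
  assumes "linear T"
  shows "C2_on S (\<lambda>x. (norm (T (x - a)))\<^sup>2)"
proof -
  have "(norm (T (x - a)))\<^sup>2 = (\<Sum>i\<in>UNIV. (adjoint T (axis i 1) \<bullet> x + (- (adjoint T (axis i 1) \<bullet> a)))\<^sup>2)" for x
  proof -
    have "T (x - a) $ i = adjoint T (axis i 1) \<bullet> x + (- (adjoint T (axis i 1) \<bullet> a))" for i
    proof -
      have "T (x - a) $ i = (x - a) \<bullet> adjoint T (axis i 1)"
        by (simp add: adjoint_works[OF assms] inner_axis)
      then show ?thesis by (simp add: inner_diff_left inner_commute)
    qed
    then show ?thesis
      by (simp add: norm_vec_def L2_set_def sum_nonneg)
  qed
  then show ?thesis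
    by (simp only:) (intro C2_on_sum C2_on_power2 C2_on_inner finite)
qed

text \<open>Crude estimate from the Leibniz formula; it serves to make a supremum of determinants
  finite.\<close>

lemma abs_det_le:
  fixes A :: "real ^ 'n ^ 'n" and B :: real
  assumes "\<And>i j. \<bar>A $ i $ j\<bar> \<le> B"
  shows "\<bar>det A\<bar> \<le> card {p. p permutes (UNIV :: 'n set)} * B ^ CARD('n)"
proof -
  have "\<bar>det A\<bar> \<le> (\<Sum>p | p permutes (UNIV :: 'n set). \<bar>of_int (sign p) * (\<Prod>i\<in>UNIV. A $ i $ p i)\<bar>)"
    unfolding det_def by (rule sum_abs)
  also have "\<dots> \<le> (\<Sum>p | p permutes (UNIV :: 'n set). B ^ CARD('n))"
  proof (rule sum_mono)
    fix p :: "'n \<Rightarrow> 'n"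
    have "(\<Prod>i\<in>UNIV. \<bar>A $ i $ p i\<bar>) \<le> (\<Prod>i\<in>(UNIV :: 'n set). B)"
      using assms by (intro prod_mono) auto
    then show "\<bar>of_int (sign p) * (\<Prod>i\<in>UNIV. A $ i $ p i)\<bar> \<le> B ^ CARD('n)"
      by (simp add: abs_mult sign_def abs_prod)
  qed
  finally show ?thesis by simp
qed

text \<open>Auerbach's argument: the rows of a matrix of nearly maximal determinant among those with
  rows in \<open>K\<close> form a basis in which, by Cramer's rule, \<open>K\<close> has bounded coordinates.\<close>

lemma symmetric_convex_body_normalization:
  fixes K :: "(real ^ 'n) set"
  assumes "open K" "bounded K" "convex K" "0 \<in> K" and sym: "\<And>h. h \<in> K \<Longrightarrow> - h \<in> K"
  obtains T :: "real ^ 'n \<Rightarrow> real ^ 'n" where "linear T"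
    and "\<And>h. norm (T h) \<le> 1 \<Longrightarrow> h \<in> K"
    and "\<And>h. h \<in> K \<Longrightarrow> norm (T h) \<le> 2 * (real CARD('n))\<^sup>2"
proof -
  define N where "N = real CARD('n)"
  have N: "1 \<le> N" unfolding N_def by (simp add: Suc_leI)
  define M where "M = {A :: real ^ 'n ^ 'n. \<forall>i. A $ i \<in> K}"
  define d where "d = (SUP A\<in>M. \<bar>det A\<bar>)"
  obtain B where B: "\<And>h. h \<in> K \<Longrightarrow> norm h \<le> B"
    using \<open>bounded K\<close> unfolding bounded_iff by blast
  have bdd: "bdd_above ((\<lambda>A. \<bar>det A\<bar>) ` M)"
  proof (rule bdd_aboveI2)
    fix A assume "A \<in> M"
    then have "\<bar>A $ i $ j\<bar> \<le> B" for i j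
      using B[of "A $ i"] component_le_norm_cart[of "A $ i" j] by (force simp: M_def)
    then show "\<bar>det A\<bar> \<le> card {p. p permutes (UNIV :: 'n set)} * B ^ CARD('n)"
      by (rule abs_det_le)
  qed
  have le_d: "\<bar>det A\<bar> \<le> d" if "A \<in> M" for A
    unfolding d_def using that bdd by (rule cSUP_upper)
  obtain e where e: "0 < e" "ball 0 e \<subseteq> K"
    using \<open>open K\<close> \<open>0 \<in> K\<close> open_contains_ball by blast
  \<comment> \<open>A multiple of the identity with rows in a small ball inside \<open>K\<close>: a
    nonsingular competitor, so the supremum \<open>d\<close> is positive.\<close>
  define E :: "real ^ 'n ^ 'n" where "E = (\<chi> i j. if i = j then e / 2 else 0)"
  have "E $ i = (e / 2) *\<^sub>R axis i 1" for i
    by (simp add: E_def vec_eq_iff axis_def)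
  then have E: "E \<in> M"
    using e by (auto simp: M_def norm_axis_1 intro!: subsetD[OF e(2)])
  have "det E = (e / 2) ^ CARD('n)"
    by (subst det_diagonal) (simp_all add: E_def)
  then have "0 < \<bar>det E\<bar>" using e by simp
  then have d: "0 < d" using le_d[OF E] by linarith
  \<comment> \<open>The supremum need not be attained on the open set \<open>K\<close>. Half of it
    suffices, at the price of the factor 2 in the bound on \<open>R\<close>.\<close>
  then obtain A where A: "A \<in> M" "d / 2 < \<bar>det A\<bar>"
    using less_cSUP_iff[OF _ bdd, of "d / 2"] E unfolding d_def[symmetric] by auto
  have det: "det A \<noteq> 0" using A d by auto
  \<comment> \<open>By Cramer's rule \<open>R k h\<close> is the coordinate of \<open>h\<close>
    along row \<open>k\<close> of \<open>A\<close>. The factor \<open>N\<close> in \<open>T\<close>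
    is chosen so that \<open>norm (T h) \<le> 1\<close> forces all these coordinates to be at most
    1/N in absolute value.\<close>
  define R where "R = (\<lambda>k h. det (\<chi> i. if i = k then h else A $ i) / det A)"
  define T where "T = (\<lambda>h. N *\<^sub>R (\<chi> k. R k h))"
  have "linear T"
  proof
    have "R k (a + b) = R k a + R k b" for k a b
      using det_row_add[of k "\<lambda>_. a" "\<lambda>_. b" "\<lambda>i. A $ i"]
      by (simp add: R_def add_divide_distrib)
    then show "T (a + b) = T a + T b" for a b
      by (simp add: T_def vec_eq_iff algebra_simps)
    have "R k (c *\<^sub>R a) = c * R k a" for k a c
      using det_row_mul[of k c "\<lambda>_. a" "\<lambda>i. A $ i", unfolded scalar_mult_eq_scaleR]
      by (simp add: R_def)
    then show "T (c *\<^sub>R a) = c *\<^sub>R T a" for c a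
      by (simp add: T_def vec_eq_iff algebra_simps)
  qed
  moreover have "norm (T h) \<le> 2 * N * N" if "h \<in> K" for h
  proof -
    have "\<bar>R k h\<bar> \<le> 2" for k
    proof -
      have "(\<chi> i. if i = k then h else A $ i) \<in> M"
        using A(1) that by (simp add: M_def)
      from le_d[OF this] A(2) have "\<bar>det (\<chi> i. if i = k then h else A $ i)\<bar> \<le> 2 * \<bar>det A\<bar>"
        by linarith
      then show ?thesis using det by (simp add: R_def field_simps)
    qed
    then have "(\<Sum>k\<in>UNIV. \<bar>T h $ k\<bar>) \<le> (\<Sum>k\<in>(UNIV :: 'n set). 2 * N)"
      using N by (intro sum_mono) (simp add: T_def abs_mult)
    also have "\<dots> = 2 * N * N" by (simp add: N_def)
    finally show ?thesis using norm_le_l1_cart[of "T h"] by linarith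
  qed
  moreover have "h \<in> K" if h: "norm (T h) \<le> 1" for h
  proof -
    have "transpose A *v (\<chi> k. R k h) = h"
    proof -
      have "R k h = det (\<chi> i j. if j = k then h $ i else transpose A $ i $ j) / det (transpose A)" for k
      proof -
        have "(\<chi> i j. if j = k then h $ i else transpose A $ i $ j) =
              transpose (\<chi> i. if i = k then h else A $ i)"
          by (simp add: vec_eq_iff transpose_def)
        then show ?thesis by (simp only: det_transpose R_def)
      qed
      then show ?thesis
        using cramer[of "transpose A" "\<chi> k. R k h" h] det by (simp add: det_transpose)
    qed
    then have "h = (\<Sum>i\<in>UNIV. (1 / N) *\<^sub>R ((T h $ i) *\<^sub>R A $ i))"
      using N by (subst \<open>_ = h\<close>[symmetric], subst matrix_mult_sum)
        (simp add: T_def scalar_mult_eq_scaleR column_def transpose_def)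
    \<comment> \<open>\<open>h\<close> is the average of these vectors, and each of them is a convex
      combination of a row of \<open>A\<close> and its negative.\<close>
    moreover have "(T h $ i) *\<^sub>R A $ i \<in> K" for i
    proof -
      have c: "\<bar>T h $ i\<bar> \<le> 1" using h component_le_norm_cart[of "T h" i] by linarith
      have "((1 + T h $ i) / 2) *\<^sub>R A $ i + ((1 - T h $ i) / 2) *\<^sub>R (- (A $ i)) \<in> K"
        using c A(1) sym[of "A $ i"] by (intro convexD[OF \<open>convex K\<close>]) (auto simp: M_def field_simps)
      moreover have "((1 + T h $ i) / 2) *\<^sub>R A $ i + ((1 - T h $ i) / 2) *\<^sub>R (- (A $ i)) =
          (((1 + T h $ i) / 2) - ((1 - T h $ i) / 2)) *\<^sub>R A $ i"
        by (simp only: scaleR_minus_right scaleR_left_diff_distrib add_uminus_conv_diff)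
      moreover have "((1 + T h $ i) / 2) - ((1 - T h $ i) / 2) = T h $ i"
        by (simp add: field_simps)
      ultimately show ?thesis by simp
    qed
    ultimately show ?thesis
      using convex_sum[of "UNIV :: 'n set" K "\<lambda>_. 1 / N" "\<lambda>i. (T h $ i) *\<^sub>R A $ i"] \<open>convex K\<close> N
      by (simp add: N_def)
  qed
  ultimately show thesis
    by (intro that[of T]) (simp_all add: N_def power2_eq_square mult.assoc)
qed

subsection \<open>Perturbed maxima\<close>

text \<open>Parallelogram law; the value depends neither on \<open>z\<close> nor on
  \<open>a\<close>, so the bump costs the same wherever the maximum lies.\<close>

lemma second_diff_norm_linear:
  fixes T :: "real ^ 'n \<Rightarrow> real ^ 'n"
  assumes "linear T"
  shows "second_diff (\<lambda>x. (norm (T (x - a)))\<^sup>2) z h = 2 * (norm (T h))\<^sup>2"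
proof -
  have "T (z + h - a) = T (z - a) + T h" "T (z - h - a) = T (z - a) - T h"
    using linear_add[OF assms, of "z - a" h] linear_diff[OF assms, of "z - a" h]
    by (simp_all add: algebra_simps)
  then show ?thesis
    unfolding second_diff_def by (simp add: power2_norm_eq_inner inner_simps inner_commute)
qed

text \<open>An approximate maximum at \<open>y\<close> is made exact by the bump \<open>\<phi>\<close>, whose ellipsoid is comparable
  with the part of \<open>\<Omega>\<close> that is symmetric about \<open>y\<close>.  In every direction the bump costs at most what
  is gained by leaving \<open>\<Omega>\<close>, where \<open>g \<le> 0\<close>; so no regularity of \<open>g\<close> at the boundary is needed.\<close>

lemma perturbed_maximum:
  fixes g :: "real ^ 'n \<Rightarrow> real"
  assumes s: "1/2 < s" "s < 1"
    and \<Omega>: "open \<Omega>" "bounded \<Omega>" "convex \<Omega>"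
    and cont: "continuous_on \<Omega> g" and bdd: "bdd_above (range g)"
    and out: "\<And>x. x \<notin> \<Omega> \<Longrightarrow> g x \<le> 0" and pos: "0 < g x'"
  obtains z \<phi> \<rho> where "z \<in> \<Omega>" "0 < g z" "C2_on UNIV \<phi>" "0 < \<rho>"
    and "\<And>x. g x - \<phi> x \<le> g z - \<phi> z"
    and "\<And>\<xi>. norm \<xi> = 1 \<Longrightarrow> \<exists>\<mu> I. has_frac_integral s \<mu> I \<and> I \<le> 0 \<and>
      (\<forall>\<tau>>0. second_diff g z (\<tau> *\<^sub>R \<xi>) \<le> \<mu> \<tau>) \<and>
      (\<forall>\<tau>>0. \<tau> < \<rho> \<longrightarrow> second_diff \<phi> z (\<tau> *\<^sub>R \<xi>) \<le> \<mu> \<tau>)"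
proof -
  define S where "S = (SUP x. g x)"
  have le_S: "g x \<le> S" for x
    unfolding S_def using bdd by (intro cSUP_upper) auto
  have S: "0 < S" using pos le_S[of x'] by linarith
  \<comment> \<open>Twice the constant of \<open>symmetric_convex_body_normalization\<close>; the
    factor 2 comes from halving a chord through \<open>z\<close> to recentre it at
    \<open>y\<close>.\<close>
  define \<Lambda> where "\<Lambda> = 4 * (real CARD('n))\<^sup>2"
  have "1 \<le> real CARD('n)" by (simp add: Suc_leI)
  then have \<Lambda>: "1 \<le> \<Lambda>" unfolding \<Lambda>_def using one_le_power[of "real CARD('n)" 2] by linarith
  obtain \<eta> \<mu> I where \<eta>: "0 < \<eta>" "2 * \<eta> < S" and \<mu>: "has_frac_integral s \<mu> I" "I \<le> 0"
    and \<mu>1: "\<And>t. 0 < t \<Longrightarrow> t < 1 \<Longrightarrow> 4 * \<eta> * t\<^sup>2 \<le> \<mu> t"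
    and \<mu>2: "\<And>t. 1 \<le> t \<Longrightarrow> 2 * \<eta> \<le> \<mu> t + (if \<Lambda> < t then S else 0)"
    using bump_kernel[OF s S \<Lambda>] by metis
  obtain y where y: "S - \<eta> < g y"
    using less_cSUP_iff[of UNIV g "S - \<eta>"] bdd \<eta> unfolding S_def[symmetric] by auto
  have "y \<in> \<Omega>" using y \<eta> out[of y] by linarith
  define K where "K = {h. y + h \<in> \<Omega> \<and> y - h \<in> \<Omega>}"
  have "open K"
    unfolding K_def using \<Omega>(1)
    by (intro open_Collect_conj open_vimage[of \<Omega>, unfolded vimage_def] continuous_intros)
  moreover have "bounded K"
  proof (rule bounded_subset)
    show "bounded ((\<lambda>x. x - y) ` \<Omega>)" by (rule bounded_translation_minus[OF \<Omega>(2)])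
    show "K \<subseteq> (\<lambda>x. x - y) ` \<Omega>"
      by (auto simp: K_def intro!: image_eqI[where x = "y + _"])
  qed
  moreover have "convex K"
  proof (rule convexI)
    fix a b :: "real ^ 'n" and u v :: real
    assume ab: "a \<in> K" "b \<in> K" and uv: "0 \<le> u" "0 \<le> v" "u + v = 1"
    have "y + (u *\<^sub>R a + v *\<^sub>R b) = u *\<^sub>R (y + a) + v *\<^sub>R (y + b)"
      "y - (u *\<^sub>R a + v *\<^sub>R b) = u *\<^sub>R (y - a) + v *\<^sub>R (y - b)"
      using uv(3) scaleR_left_distrib[of u v y] by (simp_all add: algebra_simps)
    then show "u *\<^sub>R a + v *\<^sub>R b \<in> K"
      using ab convexD[OF \<Omega>(3)] uv unfolding K_def by auto
  qed
  moreover have "0 \<in> K" "\<And>h. h \<in> K \<Longrightarrow> - h \<in> K"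
    using \<open>y \<in> \<Omega>\<close> by (auto simp: K_def)
  ultimately obtain T :: "real ^ 'n \<Rightarrow> real ^ 'n" where T: "linear T"
    and TK: "\<And>h. norm (T h) \<le> 1 \<Longrightarrow> h \<in> K" and KT: "\<And>h. h \<in> K \<Longrightarrow> norm (T h) \<le> 2 * (real CARD('n))\<^sup>2"
    using symmetric_convex_body_normalization[of K] by metis
  \<comment> \<open>A closed ellipsoid inside \<Omega>, hence a compact set on which
    \<open>g\<close> is continuous and a maximum is attained.\<close>
  define E where "E = {x. norm (T (x - y)) \<le> 1}"
  have E_sub: "E \<subseteq> \<Omega>"
    using TK unfolding E_def K_def by (force simp: algebra_simps)
  have cT: "continuous_on A (\<lambda>x. T (f x))" if "continuous_on A f" for A and f :: "real ^ 'n \<Rightarrow> real ^ 'n"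
    using T that by (simp add: linear_continuous_on_compose)
  have "closed E"
    unfolding E_def by (intro closed_Collect_le continuous_intros cT)
  then have "compact E"
    using bounded_subset[OF \<Omega>(2) E_sub] by (simp add: compact_eq_bounded_closed)
  have "y \<in> E" unfolding E_def using linear_0[OF T] by simp
  define \<phi> where "\<phi> = (\<lambda>x. 2 * \<eta> * (norm (T (x - y)))\<^sup>2)"
  have "continuous_on E (\<lambda>x. g x - \<phi> x)"
    unfolding \<phi>_def by (intro continuous_intros continuous_on_subset[OF cont E_sub] cT)
  then obtain z where z: "z \<in> E" "\<And>x. x \<in> E \<Longrightarrow> g x - \<phi> x \<le> g z - \<phi> z"
    using continuous_attains_sup[OF \<open>compact E\<close>] \<open>y \<in> E\<close> by blast
  have \<phi>y: "\<phi> y = 0" and \<phi>_nonneg: "0 \<le> \<phi> x" for x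
    using \<eta> linear_0[OF T] by (simp_all add: \<phi>_def)
  \<comment> \<open>Outside \<open>E\<close> the bump is at least 2\<eta>, which exceeds the defect
    \<eta> of the approximate maximum at \<open>y\<close>.\<close>
  have max: "g x - \<phi> x \<le> g z - \<phi> z" for x
  proof (cases "x \<in> E")
    case False
    then have "1 \<le> norm (T (x - y)) ^ 2"
      unfolding E_def by (intro one_le_power) simp
    then have "2 * \<eta> * 1 \<le> \<phi> x" unfolding \<phi>_def using \<eta> by (intro mult_left_mono) auto
    then show ?thesis using le_S[of x] y z(2)[OF \<open>y \<in> E\<close>] \<phi>y \<eta> by linarith
  qed (use z in auto)
  have gz: "S - \<eta> < g z"
    using z(2)[OF \<open>y \<in> E\<close>] \<phi>y \<phi>_nonneg[of z] y by linarith
  have sd\<phi>: "second_diff \<phi> z h = 4 * \<eta> * (norm (T h))\<^sup>2" for h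
  proof -
    have "second_diff \<phi> z h = 2 * \<eta> * second_diff (\<lambda>x. (norm (T (x - y)))\<^sup>2) z h"
      by (simp add: \<phi>_def second_diff_def algebra_simps)
    then show ?thesis by (simp add: second_diff_norm_linear[OF T])
  qed
  obtain B where B: "\<And>h. norm (T h) \<le> norm h * B" "0 < B"
    using bounded_linear.pos_bounded[OF T[unfolded linear_conv_bounded_linear]] by blast
  show thesis
  proof (rule that)
    show "z \<in> \<Omega>" using z E_sub by blast
    show "0 < g z" using gz \<eta> by linarith
    show "C2_on UNIV \<phi>"
      unfolding \<phi>_def by (intro C2_on_cmult C2_on_norm_linear T)
    \<comment> \<open>Radius below which \<open>\<theta> * \<tau> < 1\<close> in every direction, so
      that the quadratic part of \<mu> controls the bump.\<close>
    show "0 < 1 / B" using B by simp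
    show "g x - \<phi> x \<le> g z - \<phi> z" for x by (rule max)
    fix \<xi> :: "real ^ 'n" assume \<xi>: "norm \<xi> = 1"
    define \<theta> where "\<theta> = norm (T \<xi>)"
    have T\<tau>: "norm (T (\<tau> *\<^sub>R \<xi>)) = \<theta> * \<tau>" if "0 < \<tau>" for \<tau>
      using that by (simp add: \<theta>_def linear_scale[OF T])
    \<comment> \<open>A direction annihilated by \<open>T\<close> would put a whole line into the
      bounded set \<open>K\<close>.\<close>
    have \<theta>: "0 < \<theta>"
    proof (rule ccontr)
      assume "\<not> 0 < \<theta>"
      then have "T \<xi> = 0" by (simp add: \<theta>_def)
      then have "r *\<^sub>R \<xi> \<in> K" for r by (intro TK) (simp add: linear_scale[OF T])
      moreover obtain C where "\<And>h. h \<in> K \<Longrightarrow> norm h \<le> C"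
        using \<open>bounded K\<close> unfolding bounded_iff by blast
      ultimately have "norm ((\<bar>C\<bar> + 1) *\<^sub>R \<xi>) \<le> C" by blast
      then show False using \<xi> by simp
    qed
    have "has_frac_integral s (\<lambda>\<tau>. \<mu> (\<theta> * \<tau>)) (\<theta> powr (2 * s) * I)"
      by (rule has_frac_integral_scale[OF \<mu>(1) \<theta>])
    moreover have "\<theta> powr (2 * s) * I \<le> 0"
      using \<mu>(2) by (intro mult_nonneg_nonpos) auto
    moreover have "second_diff g z (\<tau> *\<^sub>R \<xi>) \<le> \<mu> (\<theta> * \<tau>)" if \<tau>: "0 < \<tau>" for \<tau>
    proof (cases "\<theta> * \<tau> < 1")
      case True
      have "second_diff g z (\<tau> *\<^sub>R \<xi>) \<le> second_diff \<phi> z (\<tau> *\<^sub>R \<xi>)"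
        using max[of "z + \<tau> *\<^sub>R \<xi>"] max[of "z - \<tau> *\<^sub>R \<xi>"] by (simp add: second_diff_def)
      also have "\<dots> \<le> \<mu> (\<theta> * \<tau>)"
        using \<mu>1[of "\<theta> * \<tau>"] True \<theta> \<tau> by (simp add: sd\<phi> T\<tau>)
      finally show ?thesis .
    next
      case False
      \<comment> \<open>As g z > S - \<eta>, two values of at most \<open>S\<close> give less than
        2\<eta>. Beyond \<Lambda> one of the two points lies outside \<Omega>, where
        \<open>g\<close> is at most 0, and a whole \<open>S\<close> is gained.\<close>
      have "second_diff g z (\<tau> *\<^sub>R \<xi>) \<le> 2 * \<eta> - (if \<Lambda> < \<theta> * \<tau> then S else 0)"
      proof (cases "\<Lambda> < \<theta> * \<tau>")
        case True
        have "z + \<tau> *\<^sub>R \<xi> \<notin> \<Omega> \<or> z - \<tau> *\<^sub>R \<xi> \<notin> \<Omega>"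
        proof (rule ccontr)
          assume "\<not> ?thesis"
          then have *: "z + \<tau> *\<^sub>R \<xi> \<in> \<Omega>" "z - \<tau> *\<^sub>R \<xi> \<in> \<Omega>" by auto
          \<comment> \<open>The reflection of \<open>z\<close> in \<open>y\<close> stays in the
            ellipsoid. Its midpoints with the two ends of the chord are symmetric about
            \<open>y\<close>, so half the chord vector lies in \<open>K\<close> and its length is
            controlled by \<open>T\<close>.\<close>
          have "2 *\<^sub>R y - z \<in> E"
            using z(1) linear_neg[OF T, of "z - y"] norm_minus_cancel[of "T (z - y)"]
            unfolding E_def by (simp add: algebra_simps scaleR_2)
          then have y': "2 *\<^sub>R y - z \<in> \<Omega>" using E_sub by blast
          have mid: "(1 / 2) *\<^sub>R a + (1 / 2) *\<^sub>R b \<in> \<Omega>" if "a \<in> \<Omega>" "b \<in> \<Omega>" for a b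
            using that by (intro convexD[OF \<Omega>(3)]) auto
          have "(\<tau> / 2) *\<^sub>R \<xi> \<in> K"
          proof -
            have "(1 / 2) *\<^sub>R (z + \<tau> *\<^sub>R \<xi>) + (1 / 2) *\<^sub>R (2 *\<^sub>R y - z) = y + (\<tau> / 2) *\<^sub>R \<xi>"
              "(1 / 2) *\<^sub>R (z - \<tau> *\<^sub>R \<xi>) + (1 / 2) *\<^sub>R (2 *\<^sub>R y - z) = y - (\<tau> / 2) *\<^sub>R \<xi>"
              by (simp_all add: vec_eq_iff field_simps)
            then show ?thesis
              using mid[OF *(1) y'] mid[OF *(2) y'] unfolding K_def by simp
          qed
          from KT[OF this] have "\<theta> * (\<tau> / 2) \<le> 2 * (real CARD('n))\<^sup>2"
            using T\<tau>[of "\<tau> / 2"] \<tau> by simp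
          then show False using True unfolding \<Lambda>_def by simp
        qed
        then show ?thesis
          using out[of "z + \<tau> *\<^sub>R \<xi>"] out[of "z - \<tau> *\<^sub>R \<xi>"] le_S[of "z + \<tau> *\<^sub>R \<xi>"] le_S[of "z - \<tau> *\<^sub>R \<xi>"]
            gz True unfolding second_diff_def by auto
      next
        case False
        then show ?thesis
          using le_S[of "z + \<tau> *\<^sub>R \<xi>"] le_S[of "z - \<tau> *\<^sub>R \<xi>"] gz unfolding second_diff_def by auto
      qed
      then show ?thesis using \<mu>2[of "\<theta> * \<tau>"] False by (auto split: if_splits)
    qed
    moreover have "second_diff \<phi> z (\<tau> *\<^sub>R \<xi>) \<le> \<mu> (\<theta> * \<tau>)" if \<tau>: "0 < \<tau>" "\<tau> < 1 / B" for \<tau>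
    proof -
      have "\<theta> * \<tau> \<le> B * \<tau>" using B(1)[of \<xi>] \<xi> \<tau> by (intro mult_right_mono) (auto simp: \<theta>_def)
      also have "\<dots> < 1" using \<tau> B(2) by (simp add: field_simps)
      finally show ?thesis using \<mu>1[of "\<theta> * \<tau>"] \<theta> \<tau> by (simp add: sd\<phi> T\<tau>)
    qed
    ultimately show "\<exists>\<mu> I. has_frac_integral s \<mu> I \<and> I \<le> 0 \<and>
      (\<forall>\<tau>>0. second_diff g z (\<tau> *\<^sub>R \<xi>) \<le> \<mu> \<tau>) \<and>
      (\<forall>\<tau>>0. \<tau> < 1 / B \<longrightarrow> second_diff \<phi> z (\<tau> *\<^sub>R \<xi>) \<le> \<mu> \<tau>)"
      by (intro exI[of _ "\<lambda>\<tau>. \<mu> (\<theta> * \<tau>)"] exI[of _ "\<theta> powr (2 * s) * I"]) blast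
  qed
qed

subsection \<open>Comparison with barriers\<close>

lemma second_diff_minus: "second_diff u x (- h) = second_diff u x h"
  by (simp add: second_diff_def)

lemma ereal_mult_le_iff_le_divide:
  assumes "0 < C"
  shows "ereal C * a \<le> ereal b \<longleftrightarrow> a \<le> ereal (b / C)"
    and "ereal b \<le> ereal C * a \<longleftrightarrow> ereal (b / C) \<le> a"
  using assms by (cases a, simp_all add: field_simps)+

text \<open>If v > u somewhere, a perturbed maximum of v - u lets v - \<phi> touch \<open>u\<close>
  from below. One direction in which \<open>v\<close> has a large operator contradicts the
  supersolution inequality, because the operator is a supremum. The barrier condition is imposed
  only where u < v, so \<open>v\<close> may be singular elsewhere.\<close>

lemma supersolution_ge:
  fixes u :: "real ^ 'n \<Rightarrow> real"
  assumes s: "1/2 < s" "s < 1"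
    and \<Omega>: "open \<Omega>" "bounded \<Omega>" "convex \<Omega>"
    and u: "viscosity_supersolution s \<Omega> f u" "continuous_on \<Omega> u"
    and f: "\<And>x. x \<in> \<Omega> \<Longrightarrow> f x \<le> M"
    and v: "continuous_on \<Omega> v" "bdd_above (range v)" and out: "\<And>x. x \<notin> \<Omega> \<Longrightarrow> v x \<le> u x"
    and sub: "\<And>x. x \<in> \<Omega> \<Longrightarrow> u x < v x \<Longrightarrow> \<exists>r>0. C2_on (ball x r) v \<and>
        (\<exists>\<xi> k I. norm \<xi> = 1 \<and> has_frac_integral s k I \<and> M < frac_const s * I \<and>
          (\<forall>\<tau>>0. k \<tau> \<le> second_diff v x (\<tau> *\<^sub>R \<xi>)))"
  shows "v x \<le> u x"
proof (rule ccontr)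
  assume "\<not> ?thesis"
  then have pos: "0 < v x - u x" by simp
  have C: "0 < frac_const s" using frac_const_pos s by simp
  have "bounded (range u)"
    using u(1) unfolding viscosity_supersolution_def L_infinity_def by blast
  have bdd: "bdd_above (range (\<lambda>x. v x - u x))"
  proof -
    obtain B where "\<And>x. norm (u x) \<le> B" using \<open>bounded (range u)\<close> unfolding bounded_iff by blast
    moreover obtain B' where "\<And>x. v x \<le> B'" using v(2) unfolding bdd_above_def by blast
    ultimately have "v x - u x \<le> B' + B" for x
      using abs_le_D2[of "u x" B] by (simp add: add_mono diff_conv_add_uminus del: add_uminus_conv_diff)
    then show ?thesis by (rule bdd_aboveI2)
  qed
  have cont: "continuous_on \<Omega> (\<lambda>x. v x - u x)"
    using u(2) v(1) by (intro continuous_on_diff)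
  have nonpos: "v x - u x \<le> 0" if "x \<notin> \<Omega>" for x
    using out[OF that] by simp
  show False
  proof (rule perturbed_maximum[OF s \<Omega> cont bdd nonpos pos])
    fix z \<phi> and \<rho>\<^sub>0 :: real
    assume z: "z \<in> \<Omega>" "0 < v z - u z" and \<phi>: "C2_on UNIV \<phi>" "0 < \<rho>\<^sub>0"
      and max: "\<And>x. v x - u x - \<phi> x \<le> v z - u z - \<phi> z"
      and bump: "\<And>\<xi>. norm \<xi> = 1 \<Longrightarrow> \<exists>\<mu> I. has_frac_integral s \<mu> I \<and> I \<le> 0 \<and>
        (\<forall>\<tau>>0. second_diff (\<lambda>x. v x - u x) z (\<tau> *\<^sub>R \<xi>) \<le> \<mu> \<tau>) \<and>
        (\<forall>\<tau>>0. \<tau> < \<rho>\<^sub>0 \<longrightarrow> second_diff \<phi> z (\<tau> *\<^sub>R \<xi>) \<le> \<mu> \<tau>)"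
    obtain r \<xi> k I where r: "0 < r" "C2_on (ball z r) v" and \<xi>: "norm \<xi> = 1"
      and k: "has_frac_integral s k I" "M < frac_const s * I"
        "\<And>\<tau>. 0 < \<tau> \<Longrightarrow> k \<tau> \<le> second_diff v z (\<tau> *\<^sub>R \<xi>)"
      using sub[OF z(1)] z(2) by auto
    obtain \<mu> J where \<mu>: "has_frac_integral s \<mu> J" "J \<le> 0"
      "\<And>\<tau>. 0 < \<tau> \<Longrightarrow> second_diff (\<lambda>x. v x - u x) z (\<tau> *\<^sub>R \<xi>) \<le> \<mu> \<tau>"
      "\<And>\<tau>. 0 < \<tau> \<Longrightarrow> \<tau> < \<rho>\<^sub>0 \<Longrightarrow> second_diff \<phi> z (\<tau> *\<^sub>R \<xi>) \<le> \<mu> \<tau>"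
      using bump[OF \<xi>] by blast
    define \<rho> where "\<rho> = min r \<rho>\<^sub>0"
    have \<rho>: "0 < \<rho>" "\<rho> \<le> r" "\<rho> \<le> \<rho>\<^sub>0" using r \<phi> by (auto simp: \<rho>_def)
    let ?\<psi> = "\<lambda>x. v x - \<phi> x"
    have "C2_on (ball z \<rho>) ?\<psi>"
      using \<rho> by (intro C2_on_diff C2_on_subset[OF r(2)] C2_on_subset[OF \<phi>(1)]) auto
    moreover have "u z - ?\<psi> z \<le> u y - ?\<psi> y" for y
      using max[of y] by linarith
    ultimately have "visc_I1_plus s \<rho> ?\<psi> u z \<le> ereal (f z)"
      using u(1) z(1) \<rho>(1) unfolding viscosity_supersolution_def by blast
    moreover have "ereal (f z) < visc_I1_plus s \<rho> ?\<psi> u z"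
    proof -
      let ?L = "\<lambda>\<xi>. ext_integral {0<..<\<rho>} (\<lambda>\<tau>. second_diff ?\<psi> z (\<tau> *\<^sub>R \<xi>) / \<tau> powr (1 + 2 * s)) +
            ext_integral {\<rho><..} (\<lambda>\<tau>. second_diff u z (\<tau> *\<^sub>R \<xi>) / \<tau> powr (1 + 2 * s))"
      have "ereal (I - J) \<le> ?L \<xi>"
      proof (rule ext_integral_split_ge[OF has_frac_integral_diff[OF k(1) \<mu>(1)] \<rho>(1)])
        show "k \<tau> - \<mu> \<tau> \<le> second_diff ?\<psi> z (\<tau> *\<^sub>R \<xi>)" if "0 < \<tau>" "\<tau> < \<rho>" for \<tau>
        proof -
          have "second_diff ?\<psi> z (\<tau> *\<^sub>R \<xi>) = second_diff v z (\<tau> *\<^sub>R \<xi>) - second_diff \<phi> z (\<tau> *\<^sub>R \<xi>)"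
            by (simp add: second_diff_def)
          then show ?thesis using k(3)[of \<tau>] \<mu>(4)[of \<tau>] that \<rho> by linarith
        qed
        \<comment> \<open>Beyond \<rho> the solution itself enters, as v - (v - u); the majorant
          \<mu> bounds the second difference of v - u at all distances.\<close>
        show "k \<tau> - \<mu> \<tau> \<le> second_diff u z (\<tau> *\<^sub>R \<xi>)" if "\<rho> < \<tau>" for \<tau>
        proof -
          have "second_diff u z (\<tau> *\<^sub>R \<xi>) =
              second_diff v z (\<tau> *\<^sub>R \<xi>) - second_diff (\<lambda>x. v x - u x) z (\<tau> *\<^sub>R \<xi>)"
            by (simp add: second_diff_def)
          then show ?thesis using k(3)[of \<tau>] \<mu>(3)[of \<tau>] that \<rho> by linarith
        qed
      qed
      also have "?L \<xi> \<le> (SUP \<xi>\<in>sphere 0 1. ?L \<xi>)"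
        using \<xi> by (intro SUP_upper) simp
      finally have "ereal (frac_const s * (I - J)) \<le> visc_I1_plus s \<rho> ?\<psi> u z"
        unfolding visc_I1_plus_def ereal_mult_le_iff_le_divide(2)[OF C] using C by simp
      moreover have "f z < frac_const s * (I - J)"
      proof -
        have "frac_const s * I \<le> frac_const s * (I - J)"
          using C \<mu>(2) by (intro mult_left_mono) auto
        then show ?thesis using f[OF z(1)] k(2) by linarith
      qed
      ultimately show ?thesis
        by (meson ereal_less(2) less_ereal.simps(1) less_le_trans)
    qed
    ultimately show False by simp
  qed
qed

text \<open>Mirror image of \<open>supersolution_ge\<close>, but now the supremum requires a bound
  in every direction. It must be uniform, hence the separate constant \<open>M'\<close>: a supremum
  of strict inequalities need not be strict.\<close>

lemma subsolution_le:
  fixes u :: "real ^ 'n \<Rightarrow> real"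
  assumes s: "1/2 < s" "s < 1"
    and \<Omega>: "open \<Omega>" "bounded \<Omega>" "convex \<Omega>"
    and u: "viscosity_subsolution s \<Omega> f u" "continuous_on \<Omega> u"
    and f: "\<And>x. x \<in> \<Omega> \<Longrightarrow> - M \<le> f x"
    and w: "continuous_on \<Omega> w" "bdd_below (range w)" and out: "\<And>x. x \<notin> \<Omega> \<Longrightarrow> u x \<le> w x"
    and M': "M < frac_const s * M'"
    and super: "\<And>x. x \<in> \<Omega> \<Longrightarrow> \<exists>r>0. C2_on (ball x r) w \<and>
        (\<forall>\<xi>. norm \<xi> = 1 \<longrightarrow> (\<exists>k I. has_frac_integral s k I \<and> I \<le> - M' \<and>
          (\<forall>\<tau>>0. second_diff w x (\<tau> *\<^sub>R \<xi>) \<le> k \<tau>)))"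
  shows "u x \<le> w x"
proof (rule ccontr)
  assume "\<not> ?thesis"
  then have pos: "0 < u x - w x" by simp
  have C: "0 < frac_const s" using frac_const_pos s by simp
  have "bounded (range u)"
    using u(1) unfolding viscosity_subsolution_def L_infinity_def by blast
  have bdd: "bdd_above (range (\<lambda>x. u x - w x))"
  proof -
    obtain B where "\<And>x. norm (u x) \<le> B" using \<open>bounded (range u)\<close> unfolding bounded_iff by blast
    moreover obtain B' where "\<And>x. B' \<le> w x" using w(2) unfolding bdd_below_def by blast
    ultimately have "u x - w x \<le> B - B'" for x
      using abs_le_D1[of "u x" B] by (simp add: diff_mono)
    then show ?thesis by (rule bdd_aboveI2)
  qed
  have cont: "continuous_on \<Omega> (\<lambda>x. u x - w x)"
    using u(2) w(1) by (intro continuous_on_diff)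
  have nonpos: "u x - w x \<le> 0" if "x \<notin> \<Omega>" for x
    using out[OF that] by simp
  show False
  proof (rule perturbed_maximum[OF s \<Omega> cont bdd nonpos pos])
    fix z \<phi> and \<rho>\<^sub>0 :: real
    assume z: "z \<in> \<Omega>" "0 < u z - w z" and \<phi>: "C2_on UNIV \<phi>" "0 < \<rho>\<^sub>0"
      and max: "\<And>x. u x - w x - \<phi> x \<le> u z - w z - \<phi> z"
      and bump: "\<And>\<xi>. norm \<xi> = 1 \<Longrightarrow> \<exists>\<mu> I. has_frac_integral s \<mu> I \<and> I \<le> 0 \<and>
        (\<forall>\<tau>>0. second_diff (\<lambda>x. u x - w x) z (\<tau> *\<^sub>R \<xi>) \<le> \<mu> \<tau>) \<and>
        (\<forall>\<tau>>0. \<tau> < \<rho>\<^sub>0 \<longrightarrow> second_diff \<phi> z (\<tau> *\<^sub>R \<xi>) \<le> \<mu> \<tau>)"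
    obtain r where r: "0 < r" "C2_on (ball z r) w"
      and k: "\<And>\<xi>. norm \<xi> = 1 \<Longrightarrow> \<exists>k I. has_frac_integral s k I \<and> I \<le> - M' \<and>
            (\<forall>\<tau>>0. second_diff w z (\<tau> *\<^sub>R \<xi>) \<le> k \<tau>)"
      using super[OF z(1)] by blast
    define \<rho> where "\<rho> = min r \<rho>\<^sub>0"
    have \<rho>: "0 < \<rho>" "\<rho> \<le> r" "\<rho> \<le> \<rho>\<^sub>0" using r \<phi> by (auto simp: \<rho>_def)
    let ?\<psi> = "\<lambda>x. w x + \<phi> x"
    have "C2_on (ball z \<rho>) ?\<psi>"
      using \<rho> by (intro C2_on_add C2_on_subset[OF r(2)] C2_on_subset[OF \<phi>(1)]) auto
    moreover have "u y - ?\<psi> y \<le> u z - ?\<psi> z" for y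
      using max[of y] by linarith
    ultimately have "ereal (f z) \<le> visc_I1_plus s \<rho> ?\<psi> u z"
      using u(1) z(1) \<rho>(1) unfolding viscosity_subsolution_def by blast
    moreover have "visc_I1_plus s \<rho> ?\<psi> u z < ereal (f z)"
    proof -
      let ?L = "\<lambda>\<xi>. ext_integral {0<..<\<rho>} (\<lambda>\<tau>. second_diff ?\<psi> z (\<tau> *\<^sub>R \<xi>) / \<tau> powr (1 + 2 * s)) +
            ext_integral {\<rho><..} (\<lambda>\<tau>. second_diff u z (\<tau> *\<^sub>R \<xi>) / \<tau> powr (1 + 2 * s))"
      have "?L \<xi> \<le> ereal (- M')" if "\<xi> \<in> sphere 0 1" for \<xi>
      proof -
        have \<xi>: "norm \<xi> = 1" using that by simp
        obtain k I where k: "has_frac_integral s k I" "I \<le> - M'"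
          "\<And>\<tau>. 0 < \<tau> \<Longrightarrow> second_diff w z (\<tau> *\<^sub>R \<xi>) \<le> k \<tau>"
          using k[OF \<xi>] by blast
        obtain \<mu> J where \<mu>: "has_frac_integral s \<mu> J" "J \<le> 0"
          "\<And>\<tau>. 0 < \<tau> \<Longrightarrow> second_diff (\<lambda>x. u x - w x) z (\<tau> *\<^sub>R \<xi>) \<le> \<mu> \<tau>"
          "\<And>\<tau>. 0 < \<tau> \<Longrightarrow> \<tau> < \<rho>\<^sub>0 \<Longrightarrow> second_diff \<phi> z (\<tau> *\<^sub>R \<xi>) \<le> \<mu> \<tau>"
          using bump[OF \<xi>] by blast
        have "?L \<xi> \<le> ereal (I + J)"
        proof (rule ext_integral_split_le[OF has_frac_integral_add[OF k(1) \<mu>(1)] \<rho>(1)])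
          show "second_diff ?\<psi> z (\<tau> *\<^sub>R \<xi>) \<le> k \<tau> + \<mu> \<tau>" if "0 < \<tau>" "\<tau> < \<rho>" for \<tau>
          proof -
            have "second_diff ?\<psi> z (\<tau> *\<^sub>R \<xi>) = second_diff w z (\<tau> *\<^sub>R \<xi>) + second_diff \<phi> z (\<tau> *\<^sub>R \<xi>)"
              by (simp add: second_diff_def)
            then show ?thesis using k(3)[of \<tau>] \<mu>(4)[of \<tau>] that \<rho> by linarith
          qed
          show "second_diff u z (\<tau> *\<^sub>R \<xi>) \<le> k \<tau> + \<mu> \<tau>" if "\<rho> < \<tau>" for \<tau>
          proof -
            have "second_diff u z (\<tau> *\<^sub>R \<xi>) =
                second_diff w z (\<tau> *\<^sub>R \<xi>) + second_diff (\<lambda>x. u x - w x) z (\<tau> *\<^sub>R \<xi>)"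
              by (simp add: second_diff_def)
            then show ?thesis using k(3)[of \<tau>] \<mu>(3)[of \<tau>] that \<rho> by linarith
          qed
        qed
        also have "ereal (I + J) \<le> ereal (- M')" using k(2) \<mu>(2) by simp
        finally show ?thesis .
      qed
      then have "(SUP \<xi>\<in>sphere 0 1. ?L \<xi>) \<le> ereal (- M')"
        by (rule SUP_least)
      then have "visc_I1_plus s \<rho> ?\<psi> u z \<le> ereal (frac_const s * - M')"
        unfolding visc_I1_plus_def ereal_mult_le_iff_le_divide(1)[OF C] using C by simp
      moreover have "frac_const s * - M' < f z"
        using f[OF z(1)] M' by simp
      ultimately show ?thesis
        by (meson less_ereal.simps(1) le_less_trans)
    qed
    ultimately show False by simp
  qed
qed

subsection \<open>The two barriers\<close>

text \<open>\<open>a\<close> is the position relative to the centre and \<open>p\<close> its height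
  above the tangent hyperplane. The part of \<open>a\<close> orthogonal to \<open>n\<close> has
  length at most q = sqrt(2Rp), so a \<bullet> \<xi> \<ge> - (q + R\<kappa>) with \<kappa> = n
  \<bullet> \<xi>. Staying in the ball then means \<tau>^2 < q^2 + 2\<tau>(q + R\<kappa>), which
  fails once \<tau> > 3q + 2R\<kappa>.\<close>

lemma cap_chord_le:
  fixes a n \<xi> :: "'a :: real_inner"
  assumes "norm n = 1" "norm \<xi> = 1" and a: "norm a < R" "norm (a + \<tau> *\<^sub>R \<xi>) < R"
    and p: "p = n \<bullet> a + R" and \<tau>: "0 < \<tau>" and \<kappa>: "0 \<le> n \<bullet> \<xi>"
  shows "\<tau> \<le> 3 * sqrt (2 * R * p) + 2 * (n \<bullet> \<xi>) * R"
proof -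
  define q where "q = sqrt (2 * R * p)"
  have R: "0 < R" using a(1) norm_ge_zero[of a] by linarith
  have "\<bar>n \<bullet> a\<bar> \<le> norm a"
    using Cauchy_Schwarz_ineq2[of n a] assms(1) by simp
  then have p0: "0 < p" using a(1) p by linarith
  have q: "0 \<le> q" "q\<^sup>2 = 2 * R * p" using R p0 by (simp_all add: q_def)
  have n1: "n \<bullet> n = 1" and \<xi>1: "\<xi> \<bullet> \<xi> = 1" using assms by (simp_all add: dot_square_norm)
  have aR: "a \<bullet> a < R\<^sup>2"
    using a(1) R by (simp add: dot_square_norm power_strict_mono)
  have "(a - (p - R) *\<^sub>R n) \<bullet> (a - (p - R) *\<^sub>R n) = a \<bullet> a - (p - R)\<^sup>2"
    using n1 p by (simp add: inner_simps inner_commute power2_eq_square algebra_simps)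
  then have perp: "(norm (a - (p - R) *\<^sub>R n))\<^sup>2 = a \<bullet> a - (p - R)\<^sup>2"
    by (simp only: power2_norm_eq_inner)
  have "(norm (a - (p - R) *\<^sub>R n))\<^sup>2 \<le> q\<^sup>2"
  proof -
    have "(p - R)\<^sup>2 = p\<^sup>2 - 2 * R * p + R\<^sup>2" by (simp add: power2_eq_square algebra_simps)
    then show ?thesis using aR q(2) zero_le_power2[of p] perp by linarith
  qed
  then have "norm (a - (p - R) *\<^sub>R n) \<le> q"
    using q(1) by (rule power2_le_imp_le)
  moreover have "\<bar>(a - (p - R) *\<^sub>R n) \<bullet> \<xi>\<bar> \<le> norm (a - (p - R) *\<^sub>R n)"
    using Cauchy_Schwarz_ineq2[of "a - (p - R) *\<^sub>R n" \<xi>] assms(2) by simp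
  ultimately have "- q \<le> (a - (p - R) *\<^sub>R n) \<bullet> \<xi>" by linarith
  moreover have "(a - (p - R) *\<^sub>R n) \<bullet> \<xi> = a \<bullet> \<xi> - p * (n \<bullet> \<xi>) + R * (n \<bullet> \<xi>)"
    by (simp add: inner_diff_left left_diff_distrib)
  moreover have "0 \<le> p * (n \<bullet> \<xi>)" using p0 \<kappa> by simp
  ultimately have a\<xi>: "- (q + R * (n \<bullet> \<xi>)) \<le> a \<bullet> \<xi>" by linarith
  have aa: "R\<^sup>2 - a \<bullet> a \<le> q\<^sup>2"
  proof -
    have "0 \<le> a \<bullet> a - (p - R)\<^sup>2" using perp[symmetric] by simp
    moreover have "(p - R)\<^sup>2 = p\<^sup>2 - 2 * R * p + R\<^sup>2" by (simp add: power2_eq_square algebra_simps)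
    ultimately show ?thesis using q(2) zero_le_power2[of p] by linarith
  qed
  have "(norm (a + \<tau> *\<^sub>R \<xi>))\<^sup>2 < R\<^sup>2"
    using a(2) R by (intro power_strict_mono) auto
  moreover have "(norm (a + \<tau> *\<^sub>R \<xi>))\<^sup>2 = a \<bullet> a + 2 * \<tau> * (a \<bullet> \<xi>) + \<tau>\<^sup>2"
    unfolding power2_norm_eq_inner using \<xi>1
    by (simp add: inner_simps inner_commute[of \<xi> a] power2_eq_square algebra_simps)
  ultimately have "a \<bullet> a + 2 * \<tau> * (a \<bullet> \<xi>) + \<tau>\<^sup>2 < R\<^sup>2" by simp
  moreover have "2 * \<tau> * - (q + R * (n \<bullet> \<xi>)) \<le> 2 * \<tau> * (a \<bullet> \<xi>)"
    using a\<xi> \<tau> by (intro mult_left_mono) auto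
  ultimately have lt: "\<tau>\<^sup>2 < q\<^sup>2 + 2 * \<tau> * (q + R * (n \<bullet> \<xi>))"
    using aa by (simp only: mult_minus_right)
  show ?thesis
  proof (rule ccontr)
    assume "\<not> ?thesis"
    then have gt: "3 * q + 2 * (n \<bullet> \<xi>) * R < \<tau>" unfolding q_def by simp
    have "0 \<le> (n \<bullet> \<xi>) * R" using \<kappa> R by simp
    then have "q \<le> \<tau>" using gt q(1) by linarith
    then have "q\<^sup>2 \<le> \<tau> * q" using q(1) by (simp add: power2_eq_square mult_right_mono)
    moreover have "\<tau> * (3 * q + 2 * (n \<bullet> \<xi>) * R) \<le> \<tau> * \<tau>"
      using gt \<tau> by (intro mult_left_mono) auto
    ultimately show False
      using lt by (simp add: power2_eq_square algebra_simps)
  qed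
qed

text \<open>Along a line the height is p \<plusminus> \<kappa>\<tau>, so \<open>cap_kernel\<close>
  applies: the exit time bounds the ascending side, the positive part of the height the descending
  one. Reversing \<xi> reduces to \<kappa> \<ge> 0. The constant depends on \<open>s\<close> and
  \<open>R\<close> alone, not on the ball or the normal.\<close>

lemma cap_barrier:
  assumes s: "1/2 < s" "s < 1" and R: "0 < R"
  obtains c where "0 < c"
    and "\<And>n y x \<xi> :: real ^ 'n. norm n = 1 \<Longrightarrow> x \<in> ball y R \<Longrightarrow> norm \<xi> = 1 \<Longrightarrow>
      \<exists>k I. has_frac_integral s k I \<and> I \<le> - c \<and>
        (\<forall>\<tau>>0. second_diff (\<lambda>x. if x \<in> ball y R then (n \<bullet> (x - y) + R) powr (2 * s - 1) else 0)
          x (\<tau> *\<^sub>R \<xi>) \<le> k \<tau>)"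
proof -
  obtain c where c: "0 < c"
    "\<And>p \<kappa>. 0 < p \<Longrightarrow> p \<le> 2 * R \<Longrightarrow> 0 \<le> \<kappa> \<Longrightarrow> \<exists>k I. has_frac_integral s k I \<and> I \<le> - c \<and>
      (\<forall>\<tau>>0. (if \<tau> \<le> 3 * sqrt (2 * R * p) + 2 * \<kappa> * R then (p + \<kappa> * \<tau>) powr (2 * s - 1) else 0)
         + (max 0 (p - \<kappa> * \<tau>)) powr (2 * s - 1) - 2 * p powr (2 * s - 1) \<le> k \<tau>)"
    by (rule cap_kernel[OF s R]) (rule that)
  show thesis
  proof (rule that[OF c(1)])
    fix n y x \<xi> :: "real ^ 'n"
    assume n: "norm n = 1" and x: "x \<in> ball y R" and \<xi>: "norm \<xi> = 1"
    let ?w = "\<lambda>x. if x \<in> ball y R then (n \<bullet> (x - y) + R) powr (2 * s - 1) else 0"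
    have *: "\<exists>k I. has_frac_integral s k I \<and> I \<le> - c \<and> (\<forall>\<tau>>0. second_diff ?w x (\<tau> *\<^sub>R \<xi>) \<le> k \<tau>)"
      if \<xi>: "norm \<xi> = 1" "0 \<le> n \<bullet> \<xi>" for \<xi>
    proof -
      define p where "p = n \<bullet> (x - y) + R"
      have height: "\<bar>n \<bullet> (x' - y)\<bar> < R" if "x' \<in> ball y R" for x'
      proof -
        have "\<bar>n \<bullet> (x' - y)\<bar> \<le> norm (x' - y)"
          using Cauchy_Schwarz_ineq2[of n "x' - y"] n by simp
        then show ?thesis using that by (simp add: dist_norm norm_minus_commute)
      qed
      have p: "0 < p" "p \<le> 2 * R" using height[OF x] by (auto simp: p_def)
      obtain k I where k: "has_frac_integral s k I" "I \<le> - c"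
        "\<And>\<tau>. 0 < \<tau> \<Longrightarrow> (if \<tau> \<le> 3 * sqrt (2 * R * p) + 2 * (n \<bullet> \<xi>) * R
            then (p + (n \<bullet> \<xi>) * \<tau>) powr (2 * s - 1) else 0)
         + (max 0 (p - (n \<bullet> \<xi>) * \<tau>)) powr (2 * s - 1) - 2 * p powr (2 * s - 1) \<le> k \<tau>"
        using c(2)[OF p \<xi>(2)] by blast
      have "second_diff ?w x (\<tau> *\<^sub>R \<xi>) \<le> k \<tau>" if \<tau>: "0 < \<tau>" for \<tau>
      proof -
        have "?w (x + \<tau> *\<^sub>R \<xi>) \<le> (if \<tau> \<le> 3 * sqrt (2 * R * p) + 2 * (n \<bullet> \<xi>) * R
            then (p + (n \<bullet> \<xi>) * \<tau>) powr (2 * s - 1) else 0)"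
        proof (cases "x + \<tau> *\<^sub>R \<xi> \<in> ball y R")
          case True
          have "n \<bullet> (x + \<tau> *\<^sub>R \<xi> - y) + R = p + (n \<bullet> \<xi>) * \<tau>"
            by (simp add: p_def inner_simps)
          moreover have "\<tau> \<le> 3 * sqrt (2 * R * p) + 2 * (n \<bullet> \<xi>) * R"
            using True x p_def \<tau> \<xi> n
            by (intro cap_chord_le[of n \<xi> "x - y"]) (auto simp: dist_norm norm_minus_commute algebra_simps)
          ultimately show ?thesis using True by simp
        qed simp
        moreover have "?w (x - \<tau> *\<^sub>R \<xi>) \<le> (max 0 (p - (n \<bullet> \<xi>) * \<tau>)) powr (2 * s - 1)"
        proof (cases "x - \<tau> *\<^sub>R \<xi> \<in> ball y R")
          case True
          have "n \<bullet> (x - \<tau> *\<^sub>R \<xi> - y) + R = p - (n \<bullet> \<xi>) * \<tau>"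
            by (simp add: p_def inner_simps)
          then show ?thesis using True height[OF True] by (simp add: max_def)
        qed simp
        moreover have "?w x = p powr (2 * s - 1)" using x by (simp add: p_def)
        ultimately show ?thesis
          using k(3)[OF \<tau>] unfolding second_diff_def by linarith
      qed
      then show ?thesis using k by blast
    qed
    show "\<exists>k I. has_frac_integral s k I \<and> I \<le> - c \<and> (\<forall>\<tau>>0. second_diff ?w x (\<tau> *\<^sub>R \<xi>) \<le> k \<tau>)"
    proof (cases "0 \<le> n \<bullet> \<xi>")
      case False
      then show ?thesis using *[of "- \<xi>"] \<xi> second_diff_minus[of ?w x "_ *\<^sub>R \<xi>"] by simp
    qed (use * \<xi> in blast)
  qed
qed

text \<open>Some ball of the family misses \<open>z\<close>. With \<open>n\<close> pointing from
  \<open>z\<close> to its centre, \<open>z\<close> lies on or below the tangent hyperplane with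
  normal \<open>n\<close>, so the height of \<open>x\<close> is at most \<open>dist x z\<close> and
  the barrier of that ball bounds \<open>u\<close>.\<close>

lemma subsolution_boundary_growth:
  fixes u :: "real ^ 'n \<Rightarrow> real"
  assumes s: "1/2 < s" "s < 1"
    and \<Omega>: "open \<Omega>" "bounded \<Omega>" "convex \<Omega>" and R: "0 < R" and balls: "\<Omega> = (\<Inter>y\<in>Y. ball y R)"
    and u: "viscosity_subsolution s \<Omega> f u" "continuous_on \<Omega> u" "\<And>x. x \<notin> \<Omega> \<Longrightarrow> u x = 0"
    and f: "\<And>x. x \<in> \<Omega> \<Longrightarrow> - M \<le> f x"
  obtains K where "0 \<le> K" "\<And>x z. z \<notin> \<Omega> \<Longrightarrow> u x \<le> K * dist x z powr (2 * s - 1)"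
proof -
  obtain c where c: "0 < c"
    "\<And>n y x \<xi> :: real ^ 'n. norm n = 1 \<Longrightarrow> x \<in> ball y R \<Longrightarrow> norm \<xi> = 1 \<Longrightarrow>
      \<exists>k I. has_frac_integral s k I \<and> I \<le> - c \<and>
        (\<forall>\<tau>>0. second_diff (\<lambda>x. if x \<in> ball y R then (n \<bullet> (x - y) + R) powr (2 * s - 1) else 0)
          x (\<tau> *\<^sub>R \<xi>) \<le> k \<tau>)"
    by (rule cap_barrier[OF s R]) (rule that)
  have C: "0 < frac_const s" using frac_const_pos s by simp
  \<comment> \<open>Scales the barrier so that its operator is at most -(|M| + 1) in every
    direction; the same \<open>K\<close> serves every \<open>z\<close>.\<close>
  define K where "K = (\<bar>M\<bar> + 1) / (frac_const s * c)"
  have "frac_const s * (K * c) = \<bar>M\<bar> + 1" using C c(1) by (simp add: K_def)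
  then have K: "0 < K" "M < frac_const s * (K * c)" using C c(1) by (simp_all add: K_def)
  have "u x \<le> K * dist x z powr (2 * s - 1)" if z: "z \<notin> \<Omega>" for x z
  proof (cases "x \<in> \<Omega>")
    case False
    then show ?thesis using u(3) K by simp
  next
    case True
    obtain y where y: "y \<in> Y" "z \<notin> ball y R" using z balls by auto
    have sub: "\<Omega> \<subseteq> ball y R" using balls y(1) by blast
    have zy: "R \<le> norm (y - z)" using y(2) by (simp add: dist_norm)
    define n where "n = (1 / norm (y - z)) *\<^sub>R (y - z)"
    have n: "norm n = 1" using zy R by (auto simp: n_def)
    define w where "w = (\<lambda>x. K * (if x \<in> ball y R then (n \<bullet> (x - y) + R) powr (2 * s - 1) else 0))"
    have height: "0 < n \<bullet> (x' - y) + R" if "x' \<in> ball y R" for x'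
    proof -
      have "\<bar>n \<bullet> (x' - y)\<bar> \<le> norm (x' - y)"
        using Cauchy_Schwarz_ineq2[of n "x' - y"] n by simp
      then show ?thesis using that by (simp add: dist_norm norm_minus_commute)
    qed
    have C2: "C2_on (ball y R) w"
    proof (rule C2_on_cong)
      show "C2_on (ball y R) (\<lambda>x. K * (n \<bullet> x + (R - n \<bullet> y)) powr (2 * s - 1))"
        using height by (intro C2_on_cmult C2_on_powr C2_on_inner) (simp add: inner_simps algebra_simps)
    qed (simp_all add: w_def inner_simps algebra_simps)
    have "u x \<le> w x"
    proof (rule subsolution_le[OF s \<Omega> u(1,2) f _ _ _ K(2)])
      have "continuous_on (ball y R) w"
        using C2 unfolding C2_on_def
        by (meson continuous_at_imp_continuous_on has_derivative_continuous)
      then show "continuous_on \<Omega> w" using sub continuous_on_subset by blast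
      show "bdd_below (range w)"
        using K by (intro bdd_belowI2[of _ 0]) (simp add: w_def)
      show "u x \<le> w x" if "x \<notin> \<Omega>" for x
        using that u(3) K by (simp add: w_def)
      fix x assume "x \<in> \<Omega>"
      then have x: "x \<in> ball y R" using sub by blast
      obtain r where "0 < r" "ball x r \<subseteq> ball y R"
        using openE[OF open_ball x] by blast
      moreover have "\<exists>k I. has_frac_integral s k I \<and> I \<le> - (K * c) \<and>
          (\<forall>\<tau>>0. second_diff w x (\<tau> *\<^sub>R \<xi>) \<le> k \<tau>)" if \<xi>: "norm \<xi> = 1" for \<xi>
      proof -
        let ?w = "\<lambda>x. if x \<in> ball y R then (n \<bullet> (x - y) + R) powr (2 * s - 1) else 0"
        obtain k I where k: "has_frac_integral s k I" "I \<le> - c"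
          "\<And>\<tau>. 0 < \<tau> \<Longrightarrow> second_diff ?w x (\<tau> *\<^sub>R \<xi>) \<le> k \<tau>"
          using c(2)[OF n x \<xi>] by blast
        have "second_diff w x h = K * second_diff ?w x h" for h
          unfolding second_diff_def w_def by (simp only: algebra_simps)
        then have "second_diff w x (\<tau> *\<^sub>R \<xi>) \<le> K * k \<tau>" if "0 < \<tau>" for \<tau>
          using k(3)[OF that] K by simp
        moreover have "K * I \<le> - (K * c)"
          using mult_left_mono[OF k(2), of K] K by simp
        ultimately show ?thesis using has_frac_integral_cmult[OF k(1), of K] by blast
      qed
      ultimately show "\<exists>r>0. C2_on (ball x r) w \<and> (\<forall>\<xi>. norm \<xi> = 1 \<longrightarrow>
          (\<exists>k I. has_frac_integral s k I \<and> I \<le> - (K * c) \<and>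
            (\<forall>\<tau>>0. second_diff w x (\<tau> *\<^sub>R \<xi>) \<le> k \<tau>)))"
        using C2_on_subset[OF C2] by blast
    qed
    also have "w x \<le> K * dist x z powr (2 * s - 1)"
    proof -
      have "n \<bullet> (y - z) = norm (y - z)"
        using zy R by (simp add: n_def dot_square_norm power2_eq_square)
      moreover have "n \<bullet> (x - z) \<le> norm (x - z)"
        using Cauchy_Schwarz_ineq2[of n "x - z"] n by simp
      moreover have "n \<bullet> (x - y) = n \<bullet> (x - z) - n \<bullet> (y - z)" by (simp add: inner_simps)
      ultimately have "n \<bullet> (x - y) + R \<le> dist x z" using zy by (simp add: dist_norm)
      moreover have "x \<in> ball y R" using True sub by blast
      moreover have "(n \<bullet> (x - y) + R) powr (2 * s - 1) \<le> dist x z powr (2 * s - 1)"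
        using calculation s height[of x] by (intro powr_mono2) auto
      ultimately show ?thesis
        using K by (simp add: w_def)
    qed
    finally show ?thesis .
  qed
  then show thesis using that[of K] K by simp
qed

section \<open>The cone barrier in the interior\<close>

lemma truncated_cone_C2:
  fixes a :: "real ^ 'n"
  assumes "x \<noteq> a" "dist x a < 1"
  shows "\<exists>r>0. C2_on (ball x r) (\<lambda>x. A - L * (min (dist x a) 1) powr b)"
proof -
  \<comment> \<open>Keeps the ball away from the apex and from the sphere where the truncation sets
    in.\<close>
  define r where "r = min (dist x a) (1 - dist x a)"
  have r: "0 < r" using assms by (simp add: r_def)
  have near: "x' \<noteq> a" "dist x' a < 1" if "x' \<in> ball x r" for x'
    using that dist_triangle[of x' a x] by (auto simp: r_def dist_commute)
  have "C2_on (ball x r) (\<lambda>x. A - L * (min (dist x a) 1) powr b)"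
  proof (rule C2_on_cong)
    \<comment> \<open>Written through the squared distance, which is a polynomial and positive off
      the apex.\<close>
    show "C2_on (ball x r) (\<lambda>x. A - L * ((norm (id (x - a)))\<^sup>2) powr (b / 2))"
      using near by (intro C2_on_diff C2_on_cmult C2_on_const C2_on_powr C2_on_norm_linear linear_id) auto
    fix x' assume x': "x' \<in> ball x r"
    have "((norm (x' - a))\<^sup>2) powr (b / 2) = norm (x' - a) powr b"
      using near(1)[OF x'] by (simp add: powr_powr flip: powr_numeral)
    then show "A - L * ((norm (id (x' - a)))\<^sup>2) powr (b / 2) = A - L * (min (dist x' a) 1) powr b"
      using near(2)[OF x'] by (simp add: dist_norm min_def)
  qed simp
  then show ?thesis using r by blast
qed

lemma supersolution_ge_cone:
  fixes u :: "real ^ 'n \<Rightarrow> real"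
  assumes s: "1/2 < s" "s < 1"
    and \<Omega>: "open \<Omega>" "bounded \<Omega>" "convex \<Omega>"
    and u: "viscosity_supersolution s \<Omega> f u" "continuous_on \<Omega> u"
    and f: "\<And>x. x \<in> \<Omega> \<Longrightarrow> f x \<le> M"
  obtains L\<^sub>0 where "\<forall>L\<ge>L\<^sub>0. \<forall>y. (\<forall>x. x \<notin> \<Omega> \<longrightarrow> u y - L * (min (dist x y) 1) powr (2 * s - 1) \<le> u x) \<longrightarrow>
    (\<forall>x. u y - L * (min (dist x y) 1) powr (2 * s - 1) \<le> u x)"
proof -
  obtain c where c: "0 < c"
    "\<And>r. 0 < r \<Longrightarrow> r < 1 \<Longrightarrow> \<exists>k. has_frac_integral s k (- c) \<and>
      (\<forall>\<tau>>0. (min (r + \<tau>) 1) powr (2 * s - 1) + (min \<bar>r - \<tau>\<bar> 1) powr (2 * s - 1)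
           - 2 * r powr (2 * s - 1) \<le> k \<tau>)"
    by (rule truncated_cone_kernel[OF s]) (rule that)
  have C: "0 < frac_const s" using frac_const_pos s by simp
  have "bounded (range u)"
    using u(1) unfolding viscosity_supersolution_def L_infinity_def by blast
  then obtain B where B: "\<And>x. \<bar>u x\<bar> \<le> B" unfolding bounded_iff by auto
  have B0: "0 \<le> B" using B[of 0] by linarith
  show thesis
  proof (rule that, intro allI impI)
    fix L y x
    \<comment> \<open>The bound 2B puts the cone below -B at distance at least 1 from
      \<open>y\<close>; the second bound makes the radial operator exceed \<open>M\<close>.\<close>
    assume L: "max (2 * B) ((\<bar>M\<bar> + 1) / (frac_const s * c)) \<le> L"
      and "\<forall>x. x \<notin> \<Omega> \<longrightarrow> u y - L * (min (dist x y) 1) powr (2 * s - 1) \<le> u x"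
    then have out: "\<And>x. x \<notin> \<Omega> \<Longrightarrow> u y - L * (min (dist x y) 1) powr (2 * s - 1) \<le> u x"
      by blast
    let ?v = "\<lambda>x. u y - L * (min (dist x y) 1) powr (2 * s - 1)"
    have L0: "0 \<le> L" "2 * B \<le> L" using L B0 by auto
    have "(\<bar>M\<bar> + 1) / (frac_const s * c) \<le> L" using L by simp
    then have "\<bar>M\<bar> + 1 \<le> L * (frac_const s * c)" using C c(1) by (simp add: pos_divide_le_eq)
    then have "M < frac_const s * (L * c)" by (simp add: mult.left_commute)
    show "?v x \<le> u x"
    proof (rule supersolution_ge[OF s \<Omega> u f _ _ out])
      show "continuous_on \<Omega> ?v"
        using s by (intro continuous_intros continuous_on_powr') auto
      show "bdd_above (range ?v)"
        using L0 by (intro bdd_aboveI2[of _ _ "u y"]) simp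
      fix x assume x: "x \<in> \<Omega>" "u x < ?v x"
      have "x \<noteq> y" using x(2) by auto
      have "dist x y < 1"
      proof (rule ccontr)
        assume "\<not> ?thesis"
        then have "?v x = u y - L" by (simp add: min_def)
        then show False using x(2) B[of x] B[of y] L0 by linarith
      qed
      define d where "d = dist x y"
      have d: "0 < d" "d < 1" using \<open>x \<noteq> y\<close> \<open>dist x y < 1\<close> by (simp_all add: d_def)
      \<comment> \<open>The radial direction: the line passes through the apex, and the distances to
        \<open>y\<close> along it are d + \<tau> and |d - \<tau>|.\<close>
      define \<xi> where "\<xi> = (1 / d) *\<^sub>R (x - y)"
      have \<xi>: "norm \<xi> = 1" using d by (simp add: \<xi>_def d_def dist_norm)
      have xy: "x - y = d *\<^sub>R \<xi>" using d by (simp add: \<xi>_def)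
      obtain k where k: "has_frac_integral s k (- c)"
        "\<And>\<tau>. 0 < \<tau> \<Longrightarrow> (min (d + \<tau>) 1) powr (2 * s - 1) + (min \<bar>d - \<tau>\<bar> 1) powr (2 * s - 1)
           - 2 * d powr (2 * s - 1) \<le> k \<tau>"
        using c(2)[OF d] by blast
      have "- L * k \<tau> \<le> second_diff ?v x (\<tau> *\<^sub>R \<xi>)" if \<tau>: "0 < \<tau>" for \<tau>
      proof -
        have "x + \<tau> *\<^sub>R \<xi> - y = (d + \<tau>) *\<^sub>R \<xi>" "x - \<tau> *\<^sub>R \<xi> - y = (d - \<tau>) *\<^sub>R \<xi>"
          using xy by (simp_all add: algebra_simps)
        then have dist: "dist (x + \<tau> *\<^sub>R \<xi>) y = d + \<tau>" "dist (x - \<tau> *\<^sub>R \<xi>) y = \<bar>d - \<tau>\<bar>"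
          using d \<tau> \<xi> by (simp_all add: dist_norm)
        have "second_diff ?v x (\<tau> *\<^sub>R \<xi>) = - L * ((min (d + \<tau>) 1) powr (2 * s - 1)
            + (min \<bar>d - \<tau>\<bar> 1) powr (2 * s - 1) - 2 * d powr (2 * s - 1))"
          using d unfolding second_diff_def dist by (simp add: d_def algebra_simps)
        then show ?thesis using mult_left_mono[OF k(2)[OF \<tau>] L0(1)] by simp
      qed
      moreover have "has_frac_integral s (\<lambda>\<tau>. - L * k \<tau>) (L * c)"
        using has_frac_integral_cmult[OF k(1), of "- L"] by simp
      ultimately show "\<exists>r>0. C2_on (ball x r) ?v \<and>
        (\<exists>\<xi> k I. norm \<xi> = 1 \<and> has_frac_integral s k I \<and> M < frac_const s * I \<and>
          (\<forall>\<tau>>0. k \<tau> \<le> second_diff ?v x (\<tau> *\<^sub>R \<xi>)))"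
        using truncated_cone_C2[OF \<open>x \<noteq> y\<close> \<open>dist x y < 1\<close>, of "u y" L "2 * s - 1"]
          \<xi> \<open>M < frac_const s * (L * c)\<close> by blast
    qed
  qed
qed

theorem proposition7p1:
  fixes s :: real and \<Omega> :: "(real ^ 'n) set" and f u :: "real ^ 'n \<Rightarrow> real"
  assumes "0 < s" and "s < 1"
    and "uniformly_convex_domain \<Omega>"
    and "continuous_on \<Omega> f" and "f \<in> L_infinity \<Omega>"
    and "viscosity_solution s \<Omega> f u"
    and "\<And>x. x \<notin> \<Omega> \<Longrightarrow> u x = 0"
    and "s > 1/2"
  shows "holder_continuous_on (2 * s - 1) UNIV u"
proof -
  have s: "1/2 < s" "s < 1" using assms by auto
  obtain R Y where R: "0 < R" and balls: "\<Omega> = (\<Inter>y\<in>Y. ball y R)"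
    and \<Omega>: "open \<Omega>" "bounded \<Omega>"
    using assms(3) unfolding uniformly_convex_domain_def by blast
  have "convex \<Omega>" unfolding balls by (intro convex_INT convex_ball)
  note \<Omega> = \<Omega> this
  have u: "viscosity_subsolution s \<Omega> f u" "viscosity_supersolution s \<Omega> f u" "continuous_on \<Omega> u"
    using assms(6) unfolding viscosity_solution_def by auto
  have "bounded (f ` \<Omega>)" "bounded (range u)"
    using assms(5) u(2) unfolding L_infinity_def viscosity_supersolution_def by auto
  then obtain M B where M: "\<And>x. x \<in> \<Omega> \<Longrightarrow> \<bar>f x\<bar> \<le> M" and B: "\<And>x. \<bar>u x\<bar> \<le> B"
    unfolding bounded_iff by auto
  have fM: "- M \<le> f x" "f x \<le> M" if "x \<in> \<Omega>" for x using M[OF that] by auto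
  obtain K where K: "0 \<le> K" "\<And>x z. z \<notin> \<Omega> \<Longrightarrow> u x \<le> K * dist x z powr (2 * s - 1)"
    by (rule subsolution_boundary_growth[OF s \<Omega> R balls u(1,3)], erule assms(7), erule fM(1), rule that)
  obtain L\<^sub>0 where cone: "\<forall>L\<ge>L\<^sub>0. \<forall>y.
    (\<forall>x. x \<notin> \<Omega> \<longrightarrow> u y - L * (min (dist x y) 1) powr (2 * s - 1) \<le> u x) \<longrightarrow>
    (\<forall>x. u y - L * (min (dist x y) 1) powr (2 * s - 1) \<le> u x)"
    by (rule supersolution_ge_cone[OF s \<Omega> u(2,3)], erule fM(2), rule that)
  \<comment> \<open>\<open>K\<close> handles exterior points within distance 1, \<open>B\<close>
    those farther away, and \<open>L\<^sub>0\<close> the comparison inside \<Omega>.\<close>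
  define L where "L = max L\<^sub>0 (max K B)"
  have L: "L\<^sub>0 \<le> L" "K \<le> L" "B \<le> L" "0 \<le> L" using K(1) by (auto simp: L_def)
  have one_sided: "u y - u x \<le> L * dist x y powr (2 * s - 1)" for x y
  proof -
    \<comment> \<open>As \<open>u x = 0\<close> here, the exterior condition on the cone is the
      boundary growth of \<open>u\<close>, read at \<open>y\<close> with \<open>x\<close> as the
      exterior point.\<close>
    have "u y - L * (min (dist x y) 1) powr (2 * s - 1) \<le> u x" if x: "x \<notin> \<Omega>" for x
    proof -
      have "u y \<le> L * (min (dist x y) 1) powr (2 * s - 1)"
      proof (cases "dist x y \<le> 1")
        case True
        have "u y \<le> K * dist y x powr (2 * s - 1)" by (rule K(2)[OF x])
        also have "\<dots> \<le> L * dist y x powr (2 * s - 1)" using L by (intro mult_right_mono) auto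
        finally show ?thesis using True by (simp add: dist_commute min_def)
      next
        case False
        then show ?thesis using B[of y] L by (simp add: min_def)
      qed
      then show "u y - L * (min (dist x y) 1) powr (2 * s - 1) \<le> u x"
        using assms(7)[OF x] by simp
    qed
    then have "u y - L * (min (dist x y) 1) powr (2 * s - 1) \<le> u x"
      using cone L(1) by blast
    moreover have "L * (min (dist x y) 1) powr (2 * s - 1) \<le> L * dist x y powr (2 * s - 1)"
      using L s by (intro mult_left_mono powr_mono2) auto
    ultimately show ?thesis by linarith
  qed
  show ?thesis
    unfolding holder_continuous_on_def
  proof (intro exI[of _ L] ballI)
    show "\<bar>u x - u y\<bar> \<le> L * dist x y powr (2 * s - 1)" for x y
      using one_sided[of x y] one_sided[of y x] by (simp add: dist_commute abs_le_iff)
  qed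
qed

end
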